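(* For every $m \in \mathbb{N}$ there exists a collection $\mathcal{K}$ of $2^m$ knots in $S^3$, all having the same determinant, such that for any two distinct knots $K, K' \in \mathcal{K}$, the knots $K$ and $K'$ are not symmetrically related.
   Context: Symmetric unions. Let $D$ be a knot diagram in the plane, let $\ell$ be a vertical axis (line) in the plane disjoint from $D$, and let $-D$ be the reflection of $D$ over $\ell$; it is a diagram of the mirror image $-J$ of the knot $J$ represented by $D$. Let $\Delta_0,\dots,\Delta_k$ ($k \geq 0$) be pairwise disjoint disks in the projection plane, each symmetric under reflection over $\ell$ and each meeting each of $D$ and $-D$ in a single crossingless arc (so that $\Delta_i$ contains two "vertical" arcs, one on each side of $\ell$). For integers $n_1,\dots,n_k$, let $D \sqcup -D(n_1,\dots,n_k)$ denote the diagram obtained from $D \sqcup -D$ by replacing the tangle in $\Delta_0$ with the $\infty$-tangle (two crossingless "horizontal" arcs, one joining the two upper endpoints and one joining the two lower endpoints, each crossing $\ell$), and, for $1 \le i \le k$, replacing the tangle in $\Delta_i$ with the tangle diagram consisting of $n_i$ (signed) crossings on the axis $\ell$, i.e. the two vertical arcs twisted about each other by $|n_i|$ half-twists with crossings stacked along $\ell$, with handedness given by the sign of $n_i$ under a fixed convention. A symmetric union presentation for a knot $K$ is a realization of $K$ by a diagram of the form $D \sqcup -D(n_1,\dots,n_k)$; the knot type $J$ of $D$ is then called the partial knot of this presentation. Two knots $J$ and $J'$ are symmetrically related if there exists a knot $K$ that admits a symmetric union presentation with partial knot $J$ and also a symmetric union presentation with partial knot $J'$. The determinant of a knot is the usual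 knot determinant. *)

theory Defs
  imports "Jordan_Normal_Form.Determinant"
begin

text \<open>
  Knot diagrams in the plane, up to planar isotopy and Reidemeister moves.

  A diagram is put in general position with respect to the height function and cut along horizontal
  lines into slices, each containing one elementary piece: a local maximum, a local minimum
  or a crossing.  Slices are listed from top to bottom.  Every diagram in the plane is planar isotopic
  to one of this form, and two such diagrams represent isotopic links iff they are related by the
  moves below (which include those between different slicings of one diagram).  A knot in the 3-sphere,
  up to isotopy, is therefore a class of diagrams under these moves; knots are unoriented.
\<close>


section \<open>Sliced diagrams\<close>

text \<open>
  \<open>Cap\<close> is a local maximum (two lower ends), \<open>Cup\<close> a local minimum (two upper ends).  At
  \<open>Cross True\<close> the strand from upper left to lower right passes over, at \<open>Cross False\<close> the one from
  upper right to lower left.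
\<close>

datatype piece = Cap | Cup | Cross bool

fun upper_ends :: "piece \<Rightarrow> nat" where
  "upper_ends Cap = 0"
| "upper_ends Cup = 2"
| "upper_ends (Cross s) = 2"

fun lower_ends :: "piece \<Rightarrow> nat" where
  "lower_ends Cap = 2"
| "lower_ends Cup = 0"
| "lower_ends (Cross s) = 2"

text \<open>\<open>Slice a g b\<close> is the piece \<open>g\<close> with \<open>a\<close> vertical strands to its left and \<open>b\<close> to its right.\<close>

datatype slice = Slice nat piece nat

text \<open>\<open>tangle m w n\<close>: the slices fit together, with \<open>m\<close> ends at the top and \<open>n\<close> at the bottom.\<close>

fun tangle :: "nat \<Rightarrow> slice list \<Rightarrow> nat \<Rightarrow> bool" where
  "tangle m [] n \<longleftrightarrow> m = n"
| "tangle m (Slice a g b # w) n \<longleftrightarrow>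
     m = a + upper_ends g + b \<and> tangle (a + lower_ends g + b) w n"

definition link_diagram :: "slice list \<Rightarrow> bool" where
  "link_diagram w \<longleftrightarrow> tangle 0 w 0"

text \<open>
  The strand segments of a diagram, as pairs of end points.  The point \<open>(k, j)\<close> is the \<open>j\<close>-th point
  from the left (counting from 0) on the horizontal line above slice number \<open>k\<close>.
\<close>

fun piece_segments :: "nat \<Rightarrow> nat \<Rightarrow> piece \<Rightarrow> ((nat \<times> nat) \<times> (nat \<times> nat)) set" where
  "piece_segments k a Cap = {((Suc k, a), (Suc k, Suc a))}"
| "piece_segments k a Cup = {((k, a), (k, Suc a))}"
| "piece_segments k a (Cross s) = {((k, a), (Suc k, Suc a)), ((k, Suc a), (Suc k, a))}"

fun slice_segments :: "nat \<Rightarrow> slice \<Rightarrow> ((nat \<times> nat) \<times> (nat \<times> nat)) set" where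
  "slice_segments k (Slice a g b) =
     {((k, j), (Suc k, j)) | j. j < a} \<union> piece_segments k a g \<union>
     {((k, a + upper_ends g + j), (Suc k, a + lower_ends g + j)) | j. j < b}"

definition segments :: "slice list \<Rightarrow> ((nat \<times> nat) \<times> (nat \<times> nat)) set" where
  "segments w = (\<Union>k<length w. slice_segments k (w ! k))"

text \<open>A knot diagram is a link diagram with exactly one component.\<close>

definition knot_diagram :: "slice list \<Rightarrow> bool" where
  "knot_diagram w \<longleftrightarrow> link_diagram w \<and> w \<noteq> [] \<and>
     (\<forall>p \<in> Field (segments w). \<forall>q \<in> Field (segments w).
        (p, q) \<in> (segments w \<union> (segments w)\<inverse>)\<^sup>*)"


section \<open>Isotopy and knots\<close>

text \<open>
  The first five rules are planar isotopies: exchanging the heights of two pieces in disjoint columns, cancelling a maximum against a minimum, and pulling a maximum or minimum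
  across another strand (the crossing is then seen rotated, hence the negated sign).  In the third
  Reidemeister move \<open>s\<close>, \<open>t\<close>, \<open>u\<close> are the signs at the crossings of strands 1 and 2, 1 and 3,
  2 and 3, numbered from left to right at the top; the excluded cases \<open>s = u \<noteq> t\<close> are those where no
  strand is above the two others.  The remaining versions of the Reidemeister moves (a kink on a
  vertical strand, antiparallel strands) follow from these and the planar isotopies.
\<close>

inductive local_move :: "slice list \<Rightarrow> slice list \<Rightarrow> bool" where
  exchange: "local_move
     [Slice a g (b + upper_ends h + c), Slice (a + lower_ends g + b) h c]
     [Slice (a + upper_ends g + b) h c, Slice a g (b + lower_ends h + c)]"
| zigzag_right: "local_move [Slice (Suc a) Cap b, Slice a Cup (Suc b)] []"
| zigzag_left: "local_move [Slice a Cap (Suc b), Slice (Suc a) Cup b] []"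
| slide_cap: "local_move
     [Slice a Cap (Suc b), Slice (Suc a) (Cross s) b]
     [Slice (Suc a) Cap b, Slice a (Cross (\<not> s)) (Suc b)]"
| slide_cup: "local_move
     [Slice a (Cross s) (Suc b), Slice (Suc a) Cup b]
     [Slice (Suc a) (Cross (\<not> s)) b, Slice a Cup (Suc b)]"
| reidemeister1_cap: "local_move [Slice a Cap b, Slice a (Cross s) b] [Slice a Cap b]"
| reidemeister1_cup: "local_move [Slice a (Cross s) b, Slice a Cup b] [Slice a Cup b]"
| reidemeister2: "local_move [Slice a (Cross s) b, Slice a (Cross (\<not> s)) b] []"
| reidemeister3: "\<not> (s = u \<and> s \<noteq> t) \<Longrightarrow> local_move
     [Slice a (Cross s) (Suc b), Slice (Suc a) (Cross t) b, Slice a (Cross u) (Suc b)]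
     [Slice (Suc a) (Cross u) b, Slice a (Cross t) (Suc b), Slice (Suc a) (Cross s) b]"

definition diagram_move :: "slice list \<Rightarrow> slice list \<Rightarrow> bool" where
  "diagram_move w w' \<longleftrightarrow> link_diagram w \<and> link_diagram w' \<and>
     (\<exists>u v x y. local_move x y \<and> w = u @ x @ v \<and> w' = u @ y @ v)"

definition isotopic :: "slice list \<Rightarrow> slice list \<Rightarrow> bool" where
  "isotopic = (\<lambda>w w'. diagram_move w w' \<or> diagram_move w' w)\<^sup>*\<^sup>*"

type_synonym knot = "slice list set"

definition knots :: "knot set" where
  "knots = {w. knot_diagram w} //
     {(w, w'). knot_diagram w \<and> knot_diagram w' \<and> isotopic w w'}"


section \<open>The determinant\<close>

text \<open>
  Reading the diagram from top to bottom, a new label is introduced at every maximum and for the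
  under-strand leaving a crossing; \<open>ls\<close> lists the labels on the current horizontal line and \<open>c\<close> is
  the next unused label.  The colouring relations are \<open>2 over - under - under' = 0\<close> at every crossing
  and equality of the two labels meeting at a minimum.  This is the usual presentation with one
  generator per arc, except that the identification of labels along an arc through a minimum is
  written as a relation.  A closed diagram has as many maxima as minima, hence as many labels as
  relations, and the determinant is the absolute value of a minor of codimension one.
\<close>

definition label :: "nat \<Rightarrow> nat \<Rightarrow> int" where
  "label i = (\<lambda>j. if j = i then 1 else 0)"

fun colouring_rows :: "nat \<Rightarrow> nat list \<Rightarrow> slice list \<Rightarrow> (nat \<Rightarrow> int) list" where
  "colouring_rows c ls [] = []"
| "colouring_rows c ls (Slice a Cap b # w) =
     colouring_rows (Suc c) (take a ls @ [c, c] @ drop a ls) w"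
| "colouring_rows c ls (Slice a Cup b # w) =
     (\<lambda>j. label (ls ! a) j - label (ls ! Suc a) j)
       # colouring_rows c (take a ls @ drop (a + 2) ls) w"
| "colouring_rows c ls (Slice a (Cross True) b # w) =
     (\<lambda>j. 2 * label (ls ! a) j - label (ls ! Suc a) j - label c j)
       # colouring_rows (Suc c) (take a ls @ [c, ls ! a] @ drop (a + 2) ls) w"
| "colouring_rows c ls (Slice a (Cross False) b # w) =
     (\<lambda>j. 2 * label (ls ! Suc a) j - label (ls ! a) j - label c j)
       # colouring_rows (Suc c) (take a ls @ [ls ! Suc a, c] @ drop (a + 2) ls) w"

definition diagram_determinant :: "slice list \<Rightarrow> int" where
  "diagram_determinant w =
     (let rows = colouring_rows 0 [] w; n = length rows - 1
      in \<bar>det (mat n n (\<lambda>(i, j). (rows ! i) j))\<bar>)"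

text \<open>The determinant of a diagram is invariant under the moves, so the choice is immaterial.\<close>

definition knot_determinant :: "knot \<Rightarrow> int" where
  "knot_determinant K = diagram_determinant (SOME w. w \<in> K)"


section \<open>Symmetric unions\<close>

text \<open>
  A diagram \<open>D\<close> to the left of the vertical axis together with the disks, in general position: each
  disk occupies a height interval of its own and meets \<open>D\<close> in its rightmost strand at that height.
  \<open>Infinity\<close> marks the disk in which the two vertical arcs are replaced by two horizontal ones, and
  \<open>Twist n\<close> one in which \<open>n\<close> signed crossings on the axis are inserted.
\<close>

datatype axis_tangle = Infinity | Twist int

datatype item = Half slice | Disk axis_tangle

fun partial_diagram :: "item list \<Rightarrow> slice list" where
  "partial_diagram [] = []"
| "partial_diagram (Half x # E) = x # partial_diagram E"
| "partial_diagram (Disk t # E) = partial_diagram E"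

text \<open>At every disk there is a rightmost strand (\<open>n\<close> is the number of strands of \<open>D\<close> at the top).\<close>

fun disks_meet :: "nat \<Rightarrow> item list \<Rightarrow> bool" where
  "disks_meet n [] \<longleftrightarrow> True"
| "disks_meet n (Half (Slice a g b) # E) \<longleftrightarrow> disks_meet (a + lower_ends g + b) E"
| "disks_meet n (Disk t # E) \<longleftrightarrow> 0 < n \<and> disks_meet n E"

fun reflect_piece :: "piece \<Rightarrow> piece" where
  "reflect_piece Cap = Cap"
| "reflect_piece Cup = Cup"
| "reflect_piece (Cross s) = Cross (\<not> s)"

text \<open>The tangle between the two innermost strands, with \<open>m\<close> further strands on either side.\<close>

fun axis_slices :: "nat \<Rightarrow> axis_tangle \<Rightarrow> slice list" where
  "axis_slices m Infinity = [Slice m Cup m, Slice m Cap m]"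
| "axis_slices m (Twist n) = replicate (nat \<bar>n\<bar>) (Slice m (Cross (0 < n)) m)"

text \<open>
  A piece of \<open>D\<close> and its reflection are placed one just below the other; \<open>n\<close> is the number of strands
  on either side of the axis.
\<close>

fun symmetric_union :: "nat \<Rightarrow> item list \<Rightarrow> slice list" where
  "symmetric_union n [] = []"
| "symmetric_union n (Half (Slice a g b) # E) =
     (let n' = a + lower_ends g + b
      in Slice a g (b + n) # Slice (n' + b) (reflect_piece g) a # symmetric_union n' E)"
| "symmetric_union n (Disk t # E) = axis_slices (n - 1) t @ symmetric_union n E"

definition symmetric_union_presentation :: "item list \<Rightarrow> bool" where
  "symmetric_union_presentation E \<longleftrightarrow>
     knot_diagram (partial_diagram E) \<and> disks_meet 0 E \<and>
     length (filter (\<lambda>x. x = Disk Infinity) E) = 1 \<and>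
     knot_diagram (symmetric_union 0 E)"

definition presents_with_partial :: "knot \<Rightarrow> knot \<Rightarrow> bool" where
  "presents_with_partial K J \<longleftrightarrow>
     (\<exists>E. symmetric_union_presentation E \<and> symmetric_union 0 E \<in> K \<and> partial_diagram E \<in> J)"

definition symmetrically_related :: "knot \<Rightarrow> knot \<Rightarrow> bool" where
  "symmetrically_related J J' \<longleftrightarrow>
     (\<exists>K \<in> knots. presents_with_partial K J \<and> presents_with_partial K J')"

end

theory Submission
  imports Defs
begin

text \<open>
  For a knot \<open>J\<close> let \<open>c(J)\<close> be its number of 3-colourings.  If \<open>K\<close> is a symmetric union with partial
  knot \<open>J\<close>, colouring both halves alike gives \<open>c(J) \<le> c(K)\<close>.  Conversely the difference of a colouring
  of the left half and the reflected colouring of the right half is a colouring of \<open>J\<close>, because twists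
  on the axis preserve it, and two colourings of \<open>K\<close> with the same difference and the same jump at the
  \<open>\<infinity>\<close>-tangle differ by a colouring of \<open>J\<close>; hence \<open>c(K) \<le> 3 c(J)\<^sup>2\<close>.  So symmetrically related knots
  satisfy \<open>c(J) \<le> 3 c(J')\<^sup>2\<close>.

  The connected sum of \<open>r - 1\<close> trefoils and the torus knot \<open>T(2, 3\<^sup>N\<^sup>-\<^sup>r\<^sup>+\<^sup>1)\<close> has determinant \<open>3\<^sup>N\<close> and
  \<open>3\<^sup>r\<^sup>+\<^sup>1\<close> 3-colourings.  The values \<open>r = 5\<^sup>i\<close>, \<open>i < 2\<^sup>m\<close>, with \<open>N\<close> large grow fast enough to exclude
  all relations.  Determinants of arbitrary diagrams are obtained from the numbers of \<open>q\<close>-colourings,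
  which are visibly invariant under the moves.
\<close>

section \<open>Fox colourings\<close>

text \<open>The determinant of a symmetric union is the square of that of its partial knot, so
  symmetrically related knots have equal determinants and the demand for one common determinant
  removes the obvious obstruction. What remains is the group behind the number, the first homology
  of the double branched cover: its order is the determinant, while the number of 3-colourings is
  \<open>3 ^ (1 + r)\<close> with \<open>r\<close> its 3-rank. In these terms the estimate reads
  \<open>r \<le> 2 * r' + 2\<close>, so ranks are pairwise unrelated as soon as each exceeds twice
  every smaller one by at least 3. Powers of 5 achieve this from rank 1 on; powers of 4 would just
  fail for the ranks 1 and 4. The factor 3 in the upper estimate is the price of a single free
  parameter, the jump at the \<open>Infinity\<close> disk. The determinant is evaluated on an
  unspecified diagram of a class. Instead of following minors through the moves, the modulus is
  varied: for \<open>q\<close> a positive multiple of a nonzero determinant \<open>d\<close> there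
  are \<open>q * \<bar>d\<bar>\<close> colourings, so one well chosen modulus reveals it.\<close>

text \<open>
  \<open>colourings q ls w\<close> counts the extensions of the colours \<open>ls\<close> of the strands above \<open>w\<close> to a
  \<open>q\<close>-colouring of \<open>w\<close>.  Only the colours chosen at the maxima are taken from \<open>{0..<q}\<close>; at the
  crossings they are not reduced mod \<open>q\<close>, so that most moves preserve the colours exactly.
\<close>

fun spread :: "int \<Rightarrow> piece \<Rightarrow> int list \<Rightarrow> (int list \<Rightarrow> nat) \<Rightarrow> nat" where
  "spread q Cap us F = (\<Sum>c\<in>{0..<q}. F [c, c])"
| "spread q Cup us F = (if q dvd us ! 0 - us ! 1 then F [] else 0)"
| "spread q (Cross True) us F = F [2 * us ! 0 - us ! 1, us ! 0]"
| "spread q (Cross False) us F = F [us ! 1, 2 * us ! 1 - us ! 0]"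

fun colourings :: "int \<Rightarrow> int list \<Rightarrow> slice list \<Rightarrow> nat" where
  "colourings q ls [] = 1"
| "colourings q ls (Slice a g b # w) =
     spread q g (take (upper_ends g) (drop a ls))
       (\<lambda>vs. colourings q (take a ls @ vs @ drop (a + upper_ends g) ls) w)"

section \<open>Invariance of the colouring numbers under isotopy\<close>

lemma spread_cong:
  assumes "\<And>vs. length vs = lower_ends g \<Longrightarrow> F vs = G vs"
  shows "spread q g us F = spread q g us G"
  using assms by (cases "(q, g, us, F)" rule: spread.cases) auto

lemma spread_commute:
  "spread q g us (\<lambda>vs. spread q h us' (\<lambda>vs'. F vs vs')) =
   spread q h us' (\<lambda>vs'. spread q g us (\<lambda>vs. F vs vs'))"
  by (cases "(q, g, us, \<lambda>_::int list. 0::nat)" rule: spread.cases;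
      cases "(q, h, us', \<lambda>_::int list. 0::nat)" rule: spread.cases)
    (auto intro: sum.swap)

lemma colourings_slice:
  assumes "length xs = a" "length us = upper_ends g"
  shows "colourings q (xs @ us @ ys) (Slice a g b # w) =
    spread q g us (\<lambda>vs. colourings q (xs @ vs @ ys) w)"
  using assms by simp

abbreviation congruent_lists :: "int \<Rightarrow> int list \<Rightarrow> int list \<Rightarrow> bool" where
  "congruent_lists q \<equiv> list_all2 (\<lambda>x y. q dvd x - y)"

lemma congruent_lists_refl [simp]: "congruent_lists q xs xs"
  by (rule list.rel_refl) simp

lemma list_split3:
  assumes "length ls = a + k + b"
  obtains xs us ys where "ls = xs @ us @ ys" "length xs = a" "length us = k" "length ys = b"
proof
  show "ls = take a ls @ take k (drop a ls) @ drop (a + k) ls"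
    by (metis append_take_drop_id drop_drop add.commute)
qed (use assms in auto)

lemma length_2_conv: "length us = 2 \<longleftrightarrow> (\<exists>x y. us = [x, y])"
  by (auto simp: numeral_2_eq_2 length_Suc_conv)

lemma spread_congruent:
  assumes us: "congruent_lists q us us'" "length us = upper_ends g"
    and F: "\<And>vs vs'. length vs = lower_ends g \<Longrightarrow> congruent_lists q vs vs' \<Longrightarrow> F vs = G vs'"
  shows "spread q g us F = spread q g us' G"
proof (cases g)
  case Cap
  then show ?thesis using F by (auto intro!: sum.cong)
next
  case Cup
  then obtain x y x' y' where e: "us = [x, y]" "us' = [x', y']" "q dvd x - x'" "q dvd y - y'"
    using us by (auto simp: length_2_conv list_all2_Cons1)
  have "x - y = (x' - y') + ((x - x') - (y - y'))" by simp
  then have "q dvd x - y \<longleftrightarrow> q dvd x' - y'"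
    using e by (metis dvd_add_left_iff dvd_diff)
  then show ?thesis using F[of "[]" "[]"] e Cup by auto
next
  case (Cross s)
  then obtain x y x' y' where e: "us = [x, y]" "us' = [x', y']" "q dvd x - x'" "q dvd y - y'"
    using us by (auto simp: length_2_conv list_all2_Cons1)
  have "2 * x - y - (2 * x' - y') = 2 * (x - x') - (y - y')"
    "2 * y - x - (2 * y' - x') = 2 * (y - y') - (x - x')" by simp_all
  then have "q dvd 2 * x - y - (2 * x' - y')" "q dvd 2 * y - x - (2 * y' - x')"
    using e by (metis dvd_diff dvd_mult)+
  then show ?thesis using F Cross e by (cases s) auto
qed

text \<open>Maxima pick representatives in \<open>{0..<q}\<close> whereas crossings produce
  arbitrary integers, so the count must be seen to depend on residues only. It does, since every
  piece acts by integer linear forms.\<close>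

lemma colourings_congruent:
  "congruent_lists q ls ls' \<Longrightarrow> tangle (length ls) w n \<Longrightarrow> colourings q ls w = colourings q ls' w"
proof (induction w arbitrary: ls ls')
  case (Cons x w)
  obtain a g b where x: "x = Slice a g b" by (cases x)
  with Cons.prems(2) have l: "length ls = a + upper_ends g + b"
    and t: "tangle (a + lower_ends g + b) w n" by auto
  from l obtain xs us ys where ls: "ls = xs @ us @ ys" "length xs = a" "length us = upper_ends g"
    "length ys = b" by (rule list_split3)
  then obtain xs' us' ys' where ls': "ls' = xs' @ us' @ ys'" "congruent_lists q xs xs'"
    "congruent_lists q us us'" "congruent_lists q ys ys'"
    using Cons.prems(1) by (auto simp: list_all2_append1)
  have l': "length xs' = a" "length us' = upper_ends g" using ls ls' list_all2_lengthD by metis+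
  show ?case unfolding x ls(1) ls'(1)
    unfolding colourings_slice[OF ls(2,3)] colourings_slice[OF l']
    by (rule spread_congruent[OF ls'(3) ls(3)], rule Cons.IH)
      (use ls ls' t in \<open>auto intro!: list_all2_appendI simp: add.assoc\<close>)
qed simp

text \<open>Exactly one representative satisfies the congruence, namely \<open>x mod q\<close>. This
  is how a cancelling maximum and minimum disappear, and later how an unknown determined by a
  relation can be introduced.\<close>

lemma sum_congruent_delta:
  assumes "(q::int) > 0" and "\<And>c. q dvd x - c \<Longrightarrow> F c = F x"
  shows "(\<Sum>c\<in>{0..<q}. if q dvd x - c then F c else 0) = (F x::nat)"
proof -
  have "q dvd x - c \<longleftrightarrow> c = x mod q" if "c \<in> {0..<q}" for c
    using that by (metis atLeastLessThan_iff mod_eq_dvd_iff mod_pos_pos_trivial)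
  then have "(\<Sum>c\<in>{0..<q}. if q dvd x - c then F c else 0)
      = (\<Sum>c\<in>{0..<q}. if c = x mod q then F c else 0)"
    by (intro sum.cong) auto
  also have "\<dots> = F (x mod q)" using assms(1) by simp
  also have "\<dots> = F x" by (rule assms(2)) simp
  finally show ?thesis .
qed

text \<open>Replacing \<open>c\<close> by \<open>t - c\<close> permutes the residues. This
  compensates for a maximum pulled under a strand, and for passing from a right colour to a
  left-right difference.\<close>

lemma sum_congruent_reflect:
  fixes F :: "int \<Rightarrow> nat"
  assumes "q > 0" and F: "\<And>c c'. q dvd c - c' \<Longrightarrow> F c = F c'"
  shows "(\<Sum>c\<in>{0..<q}. F (t - c)) = (\<Sum>c\<in>{0..<q}. F c)"
proof (rule sum.reindex_bij_witness[where i = "\<lambda>c. (t - c) mod q" and j = "\<lambda>c. (t - c) mod q"])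
  show "F ((t - c) mod q) = F (t - c)" for c by (rule F) (metis dvd_minus_mod dvd_diff_commute)
qed (use \<open>q > 0\<close> in \<open>auto simp: mod_diff_right_eq\<close>)

lemma sum_congruent_shift:
  fixes F :: "int \<Rightarrow> nat"
  assumes "q > 0" and F: "\<And>c c'. q dvd c - c' \<Longrightarrow> F c = F c'"
  shows "(\<Sum>c\<in>{0..<q}. F (c - t)) = (\<Sum>c\<in>{0..<q}. F c)"
proof -
  have G: "q dvd c - c' \<Longrightarrow> F (- c) = F (- c')" for c c'
    by (rule F) (simp add: dvd_diff_commute)
  show ?thesis
    using sum_congruent_reflect[of q "\<lambda>c. F (- c)" t] sum_congruent_reflect[of q F 0] assms G
    by simp
qed

text \<open>The remainder \<open>v\<close> is carried along because a move may alter the colours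
  handed on to it. As crossings act on unreduced integers, most moves are linear identities; only
  the zigzags, a maximum pulled under a strand and a minimum pulled over one need congruences.
  Exchanging heights swaps two sums.\<close>

lemma colourings_local_move:
  assumes "local_move x y" "q > 0" "tangle (length ls) (x @ v) n"
  shows "colourings q ls (x @ v) = colourings q ls (y @ v)"
  using assms
proof (induction rule: local_move.induct)
  case (exchange a g b h c)
  then have "length ls = a + upper_ends g + (b + upper_ends h + c)" by simp
  then obtain xs us ys where 1: "ls = xs @ us @ ys" "length xs = a" "length us = upper_ends g"
    "length ys = b + upper_ends h + c" by (rule list_split3)
  from 1(4) obtain zs us' ts where 2: "ys = zs @ us' @ ts" "length zs = b"
    "length us' = upper_ends h" "length ts = c" by (rule list_split3)
  have "colourings q ls ([Slice a g (b + upper_ends h + c), Slice (a + lower_ends g + b) h c] @ v)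
      = spread q g us (\<lambda>vs. spread q h us' (\<lambda>vs'. colourings q (xs @ vs @ zs @ vs' @ ts) v))"
    unfolding 1(1) append_Cons append_Nil colourings_slice[OF 1(2,3)]
  proof (rule spread_cong)
    fix vs :: "int list" assume "length vs = lower_ends g"
    then show "colourings q (xs @ vs @ ys) (Slice (a + lower_ends g + b) h c # v) =
      spread q h us' (\<lambda>vs'. colourings q (xs @ vs @ zs @ vs' @ ts) v)"
      using colourings_slice[of "xs @ vs @ zs" _ us' h q ts] 1 2 by simp
  qed
  also have "\<dots> = spread q h us' (\<lambda>vs'. spread q g us (\<lambda>vs. colourings q (xs @ vs @ zs @ vs' @ ts) v))"
    by (rule spread_commute)
  also have "\<dots> = colourings q ls ([Slice (a + upper_ends g + b) h c, Slice a g (b + lower_ends h + c)] @ v)"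
    using colourings_slice[of "xs @ us @ zs" _ us' h q ts]
      colourings_slice[of xs _ us g q] 1 2 by simp
  finally show ?case .
next
  case (zigzag_right a b)
  then have l: "length ls = a + 1 + b" and t: "tangle (Suc (a + b)) v n" by auto
  from l obtain xs us ys where "ls = xs @ us @ ys" "length xs = a" "length us = 1" "length ys = b"
    by (rule list_split3)
  then obtain z where ls: "ls = xs @ [z] @ ys" "length xs = a" "length ys = b"
    by (auto simp: length_Suc_conv)
  have "colourings q ls ([Slice (Suc a) Cap b, Slice a Cup (Suc b)] @ v) =
     (\<Sum>c\<in>{0..<q}. if q dvd z - c then colourings q (xs @ [c] @ ys) v else 0)"
    using ls by (simp add: nth_append cong: if_cong)
  also have "\<dots> = colourings q (xs @ [z] @ ys) v"
    by (rule sum_congruent_delta[OF \<open>q > 0\<close>], rule colourings_congruent[where n = n])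
      (use ls t in \<open>auto intro!: list_all2_appendI simp: dvd_diff_commute\<close>)
  finally show ?case using ls by simp
next
  case (zigzag_left a b)
  then have l: "length ls = a + 1 + b" and t: "tangle (Suc (a + b)) v n" by auto
  from l obtain xs us ys where "ls = xs @ us @ ys" "length xs = a" "length us = 1" "length ys = b"
    by (rule list_split3)
  then obtain z where ls: "ls = xs @ [z] @ ys" "length xs = a" "length ys = b"
    by (auto simp: length_Suc_conv)
  have "colourings q ls ([Slice a Cap (Suc b), Slice (Suc a) Cup b] @ v) =
     (\<Sum>c\<in>{0..<q}. if q dvd z - c then colourings q (xs @ [c] @ ys) v else 0)"
    using ls by (simp add: nth_append dvd_diff_commute cong: if_cong)
  also have "\<dots> = colourings q (xs @ [z] @ ys) v"
    by (rule sum_congruent_delta[OF \<open>q > 0\<close>], rule colourings_congruent[where n = n])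
      (use ls t in \<open>auto intro!: list_all2_appendI simp: dvd_diff_commute\<close>)
  finally show ?case using ls by simp
next
  case (slide_cap a b s)
  then have l: "length ls = a + 1 + b" and t: "tangle (a + 3 + b) v n"
    by (auto simp: eval_nat_numeral)
  from l obtain xs us ys where "ls = xs @ us @ ys" "length xs = a" "length us = 1" "length ys = b"
    by (rule list_split3)
  then obtain z where ls: "ls = xs @ [z] @ ys" "length xs = a" "length ys = b"
    by (auto simp: length_Suc_conv)
  show ?case
  proof (cases s)
    case True
    then show ?thesis using ls by (simp add: nth_append)
  next
    case False
    \<comment> \<open>Passing under the strand coloured \<open>z\<close> changes the colour of the
      maximum from \<open>c\<close> to \<open>2 * z - c\<close>, so the two sides agree only after
      reindexing the sum.\<close>
    have "(\<Sum>c\<in>{0..<q}. colourings q (xs @ [2 * z - c, z, 2 * z - (2 * z - c)] @ ys) v) =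
        (\<Sum>c\<in>{0..<q}. colourings q (xs @ [c, z, 2 * z - c] @ ys) v)"
    proof (rule sum_congruent_reflect[OF \<open>q > 0\<close>], rule colourings_congruent[where n = n])
      fix c c' assume "q dvd c - c'"
      then show "congruent_lists q (xs @ [c, z, 2 * z - c] @ ys) (xs @ [c', z, 2 * z - c'] @ ys)"
        by (auto intro!: list_all2_appendI simp: dvd_diff_commute)
    qed (use ls t in \<open>simp add: eval_nat_numeral\<close>)
    then show ?thesis using ls False by (simp add: nth_append)
  qed
next
  case (slide_cup a s b)
  then have l: "length ls = a + 3 + b" and t: "tangle (a + 1 + b) v n"
    by (auto simp: eval_nat_numeral)
  from l obtain xs us ys where "ls = xs @ us @ ys" "length xs = a" "length us = 3" "length ys = b"
    by (rule list_split3)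
  then obtain x y z where ls: "ls = xs @ [x,y,z] @ ys" "length xs = a" "length ys = b"
    by (auto simp: numeral_3_eq_3 length_Suc_conv)
  show ?case
  proof (cases s)
    case True
    have "colourings q (xs @ [2 * x - y] @ ys) v = colourings q (xs @ [2 * z - y] @ ys) v"
      if "q dvd x - z"
    proof (rule colourings_congruent[where n = n])
      have "2 * x - y - (2 * z - y) = 2 * (x - z)" by simp
      then show "congruent_lists q (xs @ [2 * x - y] @ ys) (xs @ [2 * z - y] @ ys)"
        using that by (auto intro!: list_all2_appendI simp del: right_diff_distrib_numeral)
    qed (use ls t in simp)
    then show ?thesis using ls True by (simp add: nth_append)
  next
    case False
    have "x - (2 * y - z) = - (2 * y - x - z)" by simp
    then have "q dvd x - (2 * y - z) \<longleftrightarrow> q dvd 2 * y - x - z" by (metis dvd_minus_iff)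
    then show ?thesis using ls False by (simp add: nth_append)
  qed
next
  case (reidemeister1_cap a b s)
  then have "length ls = a + 0 + b" by simp
  then obtain xs us ys where ls: "ls = xs @ us @ ys" "length xs = a" "length us = 0" "length ys = b"
    by (rule list_split3)
  show ?case using ls by (cases s) (simp_all add: nth_append)
next
  case (reidemeister1_cup a s b)
  then have "length ls = a + 2 + b" by simp
  then obtain xs us ys where "ls = xs @ us @ ys" "length xs = a" "length us = 2" "length ys = b"
    by (rule list_split3)
  then obtain x y where ls: "ls = xs @ [x,y] @ ys" "length xs = a" "length ys = b"
    by (auto simp: length_2_conv)
  show ?case using ls by (cases s) (simp_all add: nth_append)
next
  case (reidemeister2 a s b)
  then have "length ls = a + 2 + b" by simp
  then obtain xs us ys where "ls = xs @ us @ ys" "length xs = a" "length us = 2" "length ys = b"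
    by (rule list_split3)
  then obtain x y where ls: "ls = xs @ [x,y] @ ys" "length xs = a" "length ys = b"
    by (auto simp: length_2_conv)
  show ?case using ls by (cases s) (simp_all add: nth_append)
next
  case (reidemeister3 s u t a b)
  then have "length ls = a + 3 + b" by simp
  then obtain xs us ys where "ls = xs @ us @ ys" "length xs = a" "length us = 3" "length ys = b"
    by (rule list_split3)
  then obtain x y z where ls: "ls = xs @ [x,y,z] @ ys" "length xs = a" "length ys = b"
    by (auto simp: numeral_3_eq_3 length_Suc_conv)
  show ?case using ls reidemeister3(1) by (cases s; cases t; cases u) (simp_all add: nth_append algebra_simps)
qed

lemma colourings_append_cong:
  assumes "\<And>ls. tangle (length ls) x n \<Longrightarrow> colourings q ls x = colourings q ls y"
    and "tangle (length ls) (u @ x) n"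
  shows "colourings q ls (u @ x) = colourings q ls (u @ y)"
  using assms(2)
proof (induction u arbitrary: ls)
  case (Cons s u)
  obtain a g b where s: "s = Slice a g b" by (cases s)
  show ?case unfolding s append_Cons colourings.simps
    by (rule spread_cong, rule Cons.IH) (use Cons.prems s in \<open>auto simp: add.assoc\<close>)
qed (use assms in simp)

lemma colourings_isotopic:
  assumes "isotopic w w'" "q > 0"
  shows "colourings q [] w = colourings q [] w'"
proof -
  have move: "colourings q [] w = colourings q [] w'" if "diagram_move w w'" for w w'
  proof -
    from that obtain u v x y where "local_move x y" "w = u @ x @ v" "w' = u @ y @ v" "tangle 0 w 0"
      by (auto simp: diagram_move_def link_diagram_def)
    then show ?thesis
      using colourings_append_cong[of "x @ v" 0 q "y @ v" "[]" u] colourings_local_move[of x y q _ v 0]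
        \<open>q > 0\<close> by auto
  qed
  show ?thesis using assms(1) unfolding isotopic_def
    by (induction rule: rtranclp_induct) (auto dest: move)
qed

section \<open>Connected sums of torus knots\<close>

text \<open>\<open>torus_summand a\<close> ties a torus knot \<open>T(2, a)\<close> into the left one of two strands.\<close>

definition torus_summand :: "nat \<Rightarrow> slice list" where
  "torus_summand a = [Slice 1 Cap 1] @ replicate a (Slice 0 (Cross True) 2) @ [Slice 1 Cup 1]"

definition torus_sum :: "nat list \<Rightarrow> slice list" where
  "torus_sum as = Slice 0 Cap 0 # concat (map torus_summand as) @ [Slice 0 Cup 0]"

lemma tangle_append: "tangle m (u @ v) n \<longleftrightarrow> (\<exists>k. tangle m u k \<and> tangle k v n)"
  by (induction m u n rule: tangle.induct) auto

lemma tangle_torus_summand: "tangle 2 (torus_summand a) 2"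
proof -
  have "tangle 4 (replicate a (Slice 0 (Cross True) 2)) 4" by (induction a) (auto simp: eval_nat_numeral)
  then show ?thesis by (auto simp: torus_summand_def tangle_append eval_nat_numeral)
qed

lemma tangle_torus_summands: "tangle 2 (concat (map torus_summand as)) 2"
  by (induction as) (auto simp: tangle_append intro: tangle_torus_summand)

lemma link_diagram_torus_sum: "link_diagram (torus_sum as)"
  using tangle_torus_summands[of as] by (auto simp: link_diagram_def torus_sum_def tangle_append eval_nat_numeral)

text \<open>A half-twist adds \<open>x - y\<close> to both colours and so leaves their difference
  unchanged; the shifts accumulate linearly.\<close>

lemma colourings_twists:
  "colourings q (x # y # zs) (replicate a (Slice 0 (Cross True) b) @ w) =
   colourings q ((x + int a * (x - y)) # (y + int a * (x - y)) # zs) w"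
  by (induction a arbitrary: x y) (simp_all add: algebra_simps)

text \<open>Writing \<open>q = h * p\<close>, the condition becomes a congruence of \<open>y\<close>
  and \<open>t\<close> modulo \<open>p\<close>, which has \<open>h\<close> solutions in
  \<open>{0..<q}\<close>. The cofactor \<open>k\<close> serves both the gcd of a twist number with
  \<open>q\<close> and, with \<open>k = sgn g\<close>, a pivot entry that may be negative.\<close>

lemma card_dvd_mult_coprime:
  fixes g h q t :: int
  assumes "q > 0" "h > 0" "h dvd q" "g = h * k" "coprime k (q div h)"
  shows "card {y \<in> {0..<q}. q dvd g * (t - y)} = nat h"
proof -
  obtain p where p: "q = h * p" using \<open>h dvd q\<close> by blast
  have "p > 0" using assms p by (simp add: zero_less_mult_iff)
  have "q dvd g * (t - y) \<longleftrightarrow> y mod p = t mod p" for y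
  proof -
    have "q dvd g * (t - y) \<longleftrightarrow> p dvd k * (t - y)"
      using assms p by (simp add: mult.assoc)
    also have "\<dots> \<longleftrightarrow> p dvd t - y"
      using assms p by (simp add: coprime_commute coprime_dvd_mult_right_iff)
    finally show ?thesis by (metis mod_eq_dvd_iff)
  qed
  moreover have "{y \<in> {0..<q}. y mod p = t mod p} = (\<lambda>i. t mod p + p * i) ` {0..<h}"
  proof safe
    fix y assume y: "y mod p = t mod p" "y \<in> {0..<q}"
    then have "y = t mod p + p * (y div p)" by (metis mod_mult_div_eq)
    moreover have "p * (y div p) \<le> y" using \<open>p > 0\<close> by (simp add: minus_mod_eq_mult_div [symmetric])
    then have "p * (y div p) < p * h" using y p by (metis atLeastLessThan_iff mult.commute order.strict_trans1)
    then have "y div p \<in> {0..<h}"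
      using y \<open>p > 0\<close> by (simp add: pos_imp_zdiv_nonneg_iff)
    ultimately show "y \<in> (\<lambda>i. t mod p + p * i) ` {0..<h}" by blast
  next
    fix i assume i: "i \<in> {0..<h}"
    then have "p * (i + 1) \<le> p * h" using \<open>p > 0\<close> by (intro mult_left_mono) auto
    then have "t mod p + p * i < p * h" using pos_mod_bound[OF \<open>p > 0\<close>, of t]
      unfolding distrib_left by linarith
    then show "t mod p + p * i \<in> {0..<q}" using \<open>p > 0\<close> i p by (simp add: mult.commute)
  qed simp
  moreover have "inj_on (\<lambda>i. t mod p + p * i) {0..<h}" using \<open>p > 0\<close> by (auto intro: inj_onI)
  ultimately show ?thesis by (simp add: card_image)
qed

lemma card_dvd_mult_gcd:
  fixes q t :: int
  assumes "q > 0"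
  shows "card {y \<in> {0..<q}. q dvd int a * (t - y)} = nat (gcd (int a) q)"
proof (rule card_dvd_mult_coprime[OF assms])
  show "int a = gcd (int a) q * (int a div gcd (int a) q)" by simp
  show "coprime (int a div gcd (int a) q) (q div gcd (int a) q)"
    using assms by (intro div_gcd_coprime) auto
qed (use assms in auto)

text \<open>The minimum forces \<open>q\<close> to divide \<open>a * (x - y)\<close>, which is also
  the amount by which the left colour has changed. So the summand hands on the colour
  \<open>x\<close> modulo \<open>q\<close> and contributes only the number of admissible
  \<open>y\<close>.\<close>

lemma colourings_torus_summand:
  assumes "q > 0" "tangle 2 w n"
  shows "colourings q [x, z] (torus_summand a @ w) =
    nat (gcd (int a) q) * colourings q [x, z] w"
proof -
  have "colourings q [x, z] (torus_summand a @ w) = (\<Sum>y\<in>{0..<q}.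
     if q dvd int a * (x - y) then colourings q [x + int a * (x - y), z] w else 0)"
    by (simp add: torus_summand_def colourings_twists cong: if_cong)
  also have "\<dots> = (\<Sum>y\<in>{0..<q}. if q dvd int a * (x - y) then colourings q [x, z] w else 0)"
  proof (rule sum.cong[OF refl])
    fix y
    have "colourings q [x + int a * (x - y), z] w = colourings q [x, z] w"
      if "q dvd int a * (x - y)"
      by (rule colourings_congruent[where n = n]) (use that assms in \<open>simp_all add: numeral_2_eq_2\<close>)
    then show "(if q dvd int a * (x - y) then colourings q [x + int a * (x - y), z] w else 0) =
        (if q dvd int a * (x - y) then colourings q [x, z] w else 0)" by simp
  qed
  also have "\<dots> = nat (gcd (int a) q) * colourings q [x, z] w"
    using card_dvd_mult_gcd[OF assms(1), of a x] by (simp flip: sum.inter_filter)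
  finally show ?thesis .
qed

lemma colourings_torus_sum:
  assumes "q > 0"
  shows "colourings q [] (torus_sum as) = nat q * (\<Prod>a\<leftarrow>as. nat (gcd (int a) q))"
proof -
  have "colourings q [c, c] (concat (map torus_summand as) @ [Slice 0 Cup 0]) =
      (\<Prod>a\<leftarrow>as. nat (gcd (int a) q))" for c
  proof (induction as)
    case (Cons a as)
    have "tangle 2 (concat (map torus_summand as) @ [Slice 0 Cup 0]) 0"
      using tangle_torus_summands[of as] by (auto simp: tangle_append eval_nat_numeral)
    then show ?case using colourings_torus_summand[OF assms] Cons by simp
  qed simp
  then show ?thesis using assms by (simp add: torus_sum_def)
qed

section \<open>Connectedness of the torus sum diagrams\<close>

fun segments_from :: "nat \<Rightarrow> slice list \<Rightarrow> ((nat \<times> nat) \<times> (nat \<times> nat)) set" where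
  "segments_from k [] = {}"
| "segments_from k (x # w) = slice_segments k x \<union> segments_from (Suc k) w"

lemma segments_from_eq: "segments_from k w = (\<Union>i<length w. slice_segments (k + i) (w ! i))"
proof (induction w arbitrary: k)
  case (Cons x w)
  show ?case by (simp only: segments_from.simps Cons.IH length_Cons lessThan_Suc_eq_insert_0) auto
qed simp

lemma segments_eq: "segments w = segments_from 0 w"
  by (simp add: segments_def segments_from_eq)

lemma segments_from_append:
  "segments_from k (u @ v) = segments_from k u \<union> segments_from (k + length u) v"
  by (induction u arbitrary: k) auto

definition joined :: "('a \<times> 'a) set \<Rightarrow> 'a \<Rightarrow> 'a \<Rightarrow> bool" where
  "joined S p q \<longleftrightarrow> (p, q) \<in> (S \<union> S\<inverse>)\<^sup>*"

lemma joined_refl [simp]: "joined S p p" by (simp add: joined_def)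

lemma joined_segment: "(p, q) \<in> S \<Longrightarrow> joined S p q" by (auto simp: joined_def)

lemma joined_sym: "joined S p q \<Longrightarrow> joined S q p"
  unfolding joined_def by (metis converse_Un converse_converse rtrancl_converseI sup_commute)

lemma joined_trans [trans]: "joined S p q \<Longrightarrow> joined S q r \<Longrightarrow> joined S p r"
  unfolding joined_def by (rule rtrancl_trans)

lemma joined_mono: "joined S p q \<Longrightarrow> S \<subseteq> T \<Longrightarrow> joined T p q"
  unfolding joined_def by (meson Un_mono converse_mono rtrancl_mono subsetD)

lemma segments_from_twists:
  "segments_from k (replicate a (Slice 0 (Cross True) 2)) = 
    (\<Union>i<a. {((k+i, 0), (Suc (k+i), 1)), ((k+i, 1), (Suc (k+i), 0)),
            ((k+i, 2), (Suc (k+i), 2)), ((k+i, 3), (Suc (k+i), 3))})"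
proof -
  have *: "slice_segments j (Slice 0 (Cross s) 2) = {((j, 0), (Suc j, 1)), ((j, 1), (Suc j, 0)),
            ((j, 2), (Suc j, 2)), ((j, 3), (Suc j, 3))}" for j s
    by (auto simp: numeral_3_eq_3 numeral_2_eq_2 less_Suc_eq)
  show ?thesis by (simp add: segments_from_eq * del: slice_segments.simps)
qed

lemma segments_torus_summand:
  "segments_from k (torus_summand a) =
     {((k, 0), (Suc k, 0)), ((Suc k, 1), (Suc k, 2)), ((k, 1), (Suc k, 3))} \<union>
     (\<Union>i<a. {((Suc (k+i), 0), (Suc (Suc (k+i)), 1)), ((Suc (k+i), 1), (Suc (Suc (k+i)), 0)),
            ((Suc (k+i), 2), (Suc (Suc (k+i)), 2)), ((Suc (k+i), 3), (Suc (Suc (k+i)), 3))}) \<union>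
     {((Suc (k+a), 0), (k+a+2, 0)), ((Suc (k+a), 1), (Suc (k+a), 2)), ((Suc (k+a), 3), (k+a+2, 1))}"
proof -
  have 1: "slice_segments k (Slice 1 Cap 1) =
      {((k, 0), (Suc k, 0)), ((Suc k, 1), (Suc k, 2)), ((k, 1), (Suc k, 3))}" by auto
  have 2: "slice_segments j (Slice 1 Cup 1) =
      {((j, 0), (Suc j, 0)), ((j, 1), (j, 2)), ((j, 3), (Suc j, 1))}" for j by auto
  show ?thesis unfolding torus_summand_def
    by (simp add: segments_from_append segments_from_twists 1 2 del: slice_segments.simps One_nat_def)
qed

text \<open>For odd \<open>a\<close> the strand entering on the left leaves the twists in column 1,
  turns at the minimum, climbs column 2 to the maximum, runs through the twists again and leaves on
  the left; it thus meets everything in columns 0 to 2. For even \<open>a\<close> the summand would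
  contain a closed loop.\<close>

lemma joined_torus_summand:
  fixes k a :: nat
  assumes "odd a"
  defines "S \<equiv> segments_from k (torus_summand a)"
  shows "joined S (k, 0) (k+a+2, 0)" "joined S (k, 1) (k+a+2, 1)"
    "p \<in> Field S \<Longrightarrow> joined S (k, 0) p \<or> joined S (k, 1) p"
proof -
  have seg: "((k, 0), (Suc k, 0)) \<in> S" "((Suc k, 1), (Suc k, 2)) \<in> S" "((k, 1), (Suc k, 3)) \<in> S"
    "((Suc (k+a), 0), (k+a+2, 0)) \<in> S" "((Suc (k+a), 1), (Suc (k+a), 2)) \<in> S"
    "((Suc (k+a), 3), (k+a+2, 1)) \<in> S"
    by (simp_all add: S_def segments_torus_summand)
  have tw: "((Suc (k+i), 0), (Suc (Suc (k+i)), 1)) \<in> S" "((Suc (k+i), 1), (Suc (Suc (k+i)), 0)) \<in> S"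
     "((Suc (k+i), 2), (Suc (Suc (k+i)), 2)) \<in> S" "((Suc (k+i), 3), (Suc (Suc (k+i)), 3)) \<in> S"
    if "i < a" for i
    unfolding S_def segments_torus_summand by ((rule UnI1, rule UnI2, rule UN_I[of i]), use that in simp_all)+
  have 3: "joined S (k, 1) (Suc (k+i), 3)" if "i \<le> a" for i
    using that
  proof (induction i)
    case 0
    then show ?case using joined_segment[OF seg(3)] by simp
  next
    case (Suc i)
    then show ?case using joined_trans[OF _ joined_segment[OF tw(4)[of i]]] by simp
  qed
  have 2: "joined S (Suc k, 2) (Suc (k+i), 2)" if "i \<le> a" for i
    using that
  proof (induction i)
    case (Suc i)
    then show ?case using joined_trans[OF _ joined_segment[OF tw(3)[of i]]] by simp
  qed simp
  have 01: "joined S (k, 0) (Suc (k+i), if even i then 0 else 1) \<and>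
      joined S (Suc k, 2) (Suc (k+i), if even i then 1 else 0)" if "i \<le> a" for i
    using that
  proof (induction i)
    case 0
    then show ?case using joined_segment[OF seg(1)] joined_sym[OF joined_segment[OF seg(2)]] by simp
  next
    case (Suc i)
    then show ?case using joined_trans[OF _ joined_segment[OF tw(1)[of i]]]
        joined_trans[OF _ joined_segment[OF tw(2)[of i]]] by (cases "even i") simp_all
  qed
  have A: "joined S (k, 0) (Suc k, 2)"
    using 01[of a] \<open>odd a\<close> joined_trans[OF joined_segment[OF seg(5)] joined_sym[OF 2[of a]]]
      joined_trans by fastforce
  show B: "joined S (k, 0) (k+a+2, 0)"
    using joined_trans[OF A] 01[of a] \<open>odd a\<close> joined_trans[OF _ joined_segment[OF seg(4)]] by simp
  show C: "joined S (k, 1) (k+a+2, 1)"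
    using joined_trans[OF 3[of a] joined_segment[OF seg(6)]] by simp
  have 012: "joined S (k, 0) (Suc (k+i), j)" if "i \<le> a" "j \<in> {0,1,2}" for i j
    using that 01[OF that(1)] joined_trans[OF A] 2[OF that(1)] by (auto split: if_splits)
  show "joined S (k, 0) p \<or> joined S (k, 1) p" if p: "p \<in> Field S"
  proof -
    define T :: "(nat \<times> nat) set" where "T = {(k,0),(k,1),(k+a+2,0),(k+a+2,1)} \<union> {Suc k..Suc k + a} \<times> {0,1,2,3}"
    have "S \<subseteq> T \<times> T"
      unfolding S_def segments_torus_summand by (intro Un_least UN_least) (simp_all add: T_def)
    then have "p \<in> T" using p by (auto simp: Field_def)
    then consider "p \<in> {(k,0),(k,1),(k+a+2,0),(k+a+2,1)}"
      | i j where "p = (i, j)" "Suc k \<le> i" "i \<le> Suc k + a" "j \<in> {0,1,2,3}"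
      unfolding T_def by auto
    then show ?thesis
    proof cases
      case 1
      then show ?thesis using B C by auto
    next
      case 2
      then obtain l where "i = Suc (k + l)" "l \<le> a" using le_Suc_ex[of "Suc k" i] by auto
      then show ?thesis using 2 012[of l j] 3[of l] by auto
    qed
  qed
qed

text \<open>The disjunction suits the induction: within the summands the two through strands run
  separately, and the maximum on top identifies them afterwards.\<close>

lemma joined_torus_summands:
  fixes k :: nat
  assumes "\<forall>a\<in>set as. odd a"
  defines "S \<equiv> \<lambda>k as. segments_from k (concat (map torus_summand as) @ [Slice 0 Cup 0])"
  shows "p \<in> Field (S k as) \<Longrightarrow> joined (S k as) (k, 0) p \<or> joined (S k as) (k, 1) p"
  using assms(1)
proof (induction as arbitrary: k)
  case Nil
  then show ?case by (auto simp: S_def Field_def intro: joined_segment)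
next
  case (Cons a as)
  have len: "length (torus_summand a) = a + 2" by (simp add: torus_summand_def)
  define B where "B = segments_from k (torus_summand a)"
  have S: "S k (a # as) = B \<union> S (k+a+2) as"
    by (simp add: S_def B_def segments_from_append len add.assoc)
  have "odd a" using Cons.prems by simp
  note J = joined_torus_summand[OF this, where k = k, folded B_def]
  have mono: "joined B x y \<Longrightarrow> joined (S k (a # as)) x y"
    "joined (S (k+a+2) as) x y \<Longrightarrow> joined (S k (a # as)) x y" for x y
    by (auto simp: S elim: joined_mono)
  from Cons.prems(1) consider "p \<in> Field B" | "p \<in> Field (S (k+a+2) as)"
    by (auto simp: S Field_def)
  then show ?case
  proof cases
    case 1
    then show ?thesis using J(3) mono(1) by blast
  next
    case 2
    then show ?thesis using Cons.IH[of "k+a+2"] Cons.prems(2) mono J(1,2)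
      by (meson joined_trans list.set_intros(2))
  qed
qed

lemma knot_diagram_torus_sum:
  assumes "\<forall>a\<in>set as. odd a"
  shows "knot_diagram (torus_sum as)"
proof -
  define S where "S = segments_from 1 (concat (map torus_summand as) @ [Slice 0 Cup 0])"
  define T where "T = segments (torus_sum as)"
  have T: "T = insert ((1, 0), (1, 1)) S"
    by (simp add: T_def S_def segments_eq torus_sum_def)
  have ST: "joined S x y \<Longrightarrow> joined T x y" for x y by (auto simp: T elim: joined_mono)
  have 01: "joined T (1, 0) (1, 1)" by (auto simp: T intro: joined_segment)
  have *: "joined T (1, 0) p" if p: "p \<in> Field T" for p
  proof -
    have "p \<in> Field S \<or> p = (1, 0) \<or> p = (1, 1)" using p by (auto simp: T Field_def)
    then show ?thesis
      using joined_torus_summands[OF assms, of p 1, folded S_def] ST[of "(1, 0)" p] ST[of "(1, 1)" p] joined_trans[OF 01] 01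
        joined_refl[of T "(1, 0)"] by blast
  qed
  have "joined T p p'" if "p \<in> Field T" "p' \<in> Field T" for p p'
    using *[OF that(1)] *[OF that(2)] by (blast intro: joined_trans joined_sym)
  then show ?thesis using link_diagram_torus_sum[of as]
    unfolding knot_diagram_def T_def joined_def by (simp add: torus_sum_def)
qed

section \<open>Kernels of integer matrices modulo q\<close>

definition vectors :: "int \<Rightarrow> nat \<Rightarrow> int list set" where
  "vectors q k = {xs. length xs = k \<and> set xs \<subseteq> {0..<q}}"

lemma vectors_0 [simp]: "vectors q 0 = {[]}" by (auto simp: vectors_def)

lemma finite_vectors [simp]: "finite (vectors q k)"
  using finite_lists_length_eq[of "{0..<q}" k] by (simp add: vectors_def conj_commute)

lemma vectors_Suc: "vectors q (Suc k) = (\<lambda>(x, xs). x # xs) ` ({0..<q} \<times> vectors q k)"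
  by (auto simp: vectors_def length_Suc_conv image_iff)

lemma sum_vectors_Suc:
  "(\<Sum>xs\<in>vectors q (Suc k). f xs) = (\<Sum>x\<in>{0..<q}. \<Sum>xs\<in>vectors q k. f (x # xs))"
  by (subst vectors_Suc, subst sum.reindex)
    (auto simp: inj_on_def sum.cartesian_product intro!: sum.cong)

lemma card_vectors_Suc:
  "card {xs \<in> vectors q (Suc k). P xs} = (\<Sum>x\<in>{0..<q}. card {xs \<in> vectors q k. P (x # xs)})"
proof -
  have c: "card {xs \<in> vectors q j. Q xs} = (\<Sum>xs\<in>vectors q j. if Q xs then 1 else 0)" for j Q
    by (simp flip: sum.inter_filter)
  show ?thesis by (simp only: c sum_vectors_Suc)
qed

definition kernel_mod :: "int \<Rightarrow> nat \<Rightarrow> int mat \<Rightarrow> int list set" where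
  "kernel_mod q n M = {xs \<in> vectors q n. \<forall>i<n. q dvd (\<Sum>j<n. M $$ (i, j) * xs ! j)}"

lemma finite_kernel_mod [simp]: "finite (kernel_mod q n M)"
  by (simp add: kernel_mod_def)

lemma kernel_mod_addrow:
  assumes "M \<in> carrier_mat n n" "i < n" "k < n" "i \<noteq> k"
  shows "kernel_mod q n (addrow c i k M) = kernel_mod q n M"
proof -
  have "(\<forall>l<n. q dvd (\<Sum>j<n. addrow c i k M $$ (l, j) * xs ! j)) \<longleftrightarrow>
      (\<forall>l<n. q dvd (\<Sum>j<n. M $$ (l, j) * xs ! j))" (is "?A \<longleftrightarrow> ?B") for xs
  proof -
    define s where "s l = (\<Sum>j<n. M $$ (l, j) * xs ! j)" for l
    have *: "(\<Sum>j<n. addrow c i k M $$ (l, j) * xs ! j) = (if l = i then c * s k + s i else s l)"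
      if "l < n" for l
      using assms that by (auto simp: s_def algebra_simps sum.distrib sum_distrib_left)
    have "?A \<longleftrightarrow> (\<forall>l<n. q dvd (if l = i then c * s k + s i else s l))" using * by simp
    also have "\<dots> \<longleftrightarrow> (\<forall>l<n. q dvd s l)"
      using assms(2-4) by (metis dvd_add_right_iff dvd_mult)
    finally show ?thesis by (simp add: s_def)
  qed
  then show ?thesis by (simp add: kernel_mod_def)
qed

text \<open>Multiplying the congruences by the adjugate gives \<open>q dvd det M * xs ! j\<close>.
  This will guarantee that a pivot equation can be solved.\<close>

lemma kernel_mod_dvd:
  assumes M: "M \<in> carrier_mat n n" and "det M * g dvd q" "det M \<noteq> 0"
    and xs: "xs \<in> kernel_mod q n M" and "j < n"
  shows "g dvd xs ! j"
proof -
  define v where "v = vec n (\<lambda>j. xs ! j)"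
  have v: "v \<in> carrier_vec n" by (simp add: v_def)
  note adj = adj_mat[OF M]
  have row: "q dvd (M *\<^sub>v v) $ i" if "i < n" for i
    using xs that M by (auto simp: kernel_mod_def v_def scalar_prod_def atLeast0LessThan)
  have "det M * xs ! j = ((det M \<cdot>\<^sub>m 1\<^sub>m n) *\<^sub>v v) $ j"
    using \<open>j < n\<close> by (simp add: v_def)
  also have "\<dots> = (adj_mat M *\<^sub>v (M *\<^sub>v v)) $ j"
    using adj(3) assoc_mult_mat_vec[OF adj(1) M v] by simp
  also have "\<dots> = (\<Sum>i<n. adj_mat M $$ (j, i) * (M *\<^sub>v v) $ i)"
    using adj(1) M \<open>j < n\<close> by (simp add: scalar_prod_def atLeast0LessThan)
  also have "q dvd \<dots>" using row by (intro dvd_sum) (simp add: dvd_mult)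
  finally have "det M * g dvd det M * xs ! j" using assms(2) dvd_trans by blast
  then show ?thesis using \<open>det M \<noteq> 0\<close> by simp
qed

text \<open>As column 0 vanishes outside row \<open>i\<close>, the other rows are the system of the
  minor in the remaining unknowns, and row \<open>i\<close> alone constrains the first unknown. The
  kernel is thus fibred over that of the minor.\<close>

lemma kernel_mod_pivot:
  assumes M: "M \<in> carrier_mat (Suc n) (Suc n)" and i: "i < Suc n"
    and zero: "\<And>k. k < Suc n \<Longrightarrow> k \<noteq> i \<Longrightarrow> M $$ (k, 0) = 0"
  shows "kernel_mod q (Suc n) M = (\<lambda>(xs, x). x # xs) `
    (SIGMA xs : kernel_mod q n (mat_delete M i 0).
      {x \<in> {0..<q}. q dvd M $$ (i, 0) * x + (\<Sum>j<n. M $$ (i, Suc j) * xs ! j)})"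
proof -
  have rows: "(\<forall>k<Suc n. P k) \<longleftrightarrow> P i \<and> (\<forall>k<n. P (insert_index i k))" for P
  proof -
    have "{0..<Suc n} = insert i (insert_index i ` {0..<n})"
      using insert_index_image[OF i] i by auto
    then have "(\<forall>k\<in>{0..<Suc n}. P k) \<longleftrightarrow> P i \<and> (\<forall>k\<in>{0..<n}. P (insert_index i k))" by simp
    then show ?thesis by (auto simp: atLeast0LessThan)
  qed
  have val: "(\<Sum>j<Suc n. M $$ (k, j) * (x # xs) ! j) =
      M $$ (k, 0) * x + (\<Sum>j<n. M $$ (k, Suc j) * xs ! j)" for k x xs
    by (simp add: sum.lessThan_Suc_shift del: sum.lessThan_Suc)
  have del: "mat_delete M i 0 $$ (k, j) = M $$ (insert_index i k, Suc j)" if "k < n" "j < n" for k j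
    using mat_delete_index[OF M i, of 0 k j] that by simp
  have "x # xs \<in> kernel_mod q (Suc n) M \<longleftrightarrow> xs \<in> kernel_mod q n (mat_delete M i 0) \<and>
      x \<in> {0..<q} \<and> q dvd M $$ (i, 0) * x + (\<Sum>j<n. M $$ (i, Suc j) * xs ! j)" for x xs
  proof -
    have "insert_index i k < Suc n" if "k < n" for k
      using that by (simp add: insert_index_def)
    then have "M $$ (insert_index i k, 0) = 0" if "k < n" for k
      using zero that by simp
    then show ?thesis
      unfolding kernel_mod_def mem_Collect_eq rows val by (auto simp: vectors_def del)
  qed
  moreover have "\<exists>x xs. ys = x # xs" if "ys \<in> kernel_mod q (Suc n) M" for ys
    using that by (auto simp: kernel_mod_def vectors_def length_Suc_conv)
  ultimately show ?thesis by (fastforce simp: image_iff)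
qed

text \<open>By Smith normal form the kernel has as many elements as the product of the gcds of
  \<open>q\<close> with the diagonal entries, which is \<open>\<bar>det M\<bar>\<close> once the
  determinant divides \<open>q\<close>. Row operations suffice to see this: Euclid's algorithm on
  the first column isolates a pivot \<open>g\<close>, and each vector in the kernel of the minor
  extends in \<open>\<bar>g\<bar>\<close> ways.\<close>

lemma card_kernel_mod:
  assumes "M \<in> carrier_mat n n" "det M dvd q" "q > 0"
  shows "int (card (kernel_mod q n M)) = \<bar>det M\<bar>"
  using assms(1,2)
proof (induction n arbitrary: M)
  case 0
  then show ?case by (simp add: kernel_mod_def)
next
  case (Suc n)
  note IH = Suc.IH
  show ?case using Suc.prems
  proof (induction "\<Sum>i<Suc n. nat \<bar>M $$ (i, 0)\<bar>" arbitrary: M rule: less_induct)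
    case less
    note M = less.prems(1)
    show ?case
    proof (cases "\<exists>i k. i < Suc n \<and> k < Suc n \<and> i \<noteq> k \<and> M $$ (k, 0) \<noteq> 0 \<and> \<bar>M $$ (k, 0)\<bar> \<le> \<bar>M $$ (i, 0)\<bar>")
      case True
      then obtain i k where ik: "i < Suc n" "k < Suc n" "i \<noteq> k" "M $$ (k, 0) \<noteq> 0"
        "\<bar>M $$ (k, 0)\<bar> \<le> \<bar>M $$ (i, 0)\<bar>" by blast
      \<comment> \<open>One copy of row \<open>k\<close> is added or subtracted, with the sign that
        moves the first entry of row \<open>i\<close> towards 0. That entry strictly shrinks in
        absolute value, while determinant and kernel stay the same.\<close>
      define A where "A = addrow (- (sgn (M $$ (i, 0)) * sgn (M $$ (k, 0)))) i k M"
      have A: "A \<in> carrier_mat (Suc n) (Suc n)" using M by (simp add: A_def)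
      have det: "det A = det M" unfolding A_def by (rule det_addrow[OF ik(2,3) M])
      have entry: "A $$ (l, 0) = (if l = i then M $$ (i, 0) - sgn (M $$ (i, 0)) * \<bar>M $$ (k, 0)\<bar>
          else M $$ (l, 0))" if "l < Suc n" for l
        using M that ik by (simp add: A_def abs_sgn mult.commute)
      have less_i: "\<bar>A $$ (i, 0)\<bar> < \<bar>M $$ (i, 0)\<bar>"
        using ik by (auto simp: entry sgn_if)
      have "(\<Sum>l<Suc n. nat \<bar>A $$ (l, 0)\<bar>) < (\<Sum>l<Suc n. nat \<bar>M $$ (l, 0)\<bar>)"
      proof (rule sum_strict_mono_ex1)
        show "\<forall>l\<in>{..<Suc n}. nat \<bar>A $$ (l, 0)\<bar> \<le> nat \<bar>M $$ (l, 0)\<bar>"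
          using less_i entry by fastforce
        show "\<exists>l\<in>{..<Suc n}. nat \<bar>A $$ (l, 0)\<bar> < nat \<bar>M $$ (l, 0)\<bar>"
          using less_i ik(1) by (intro bexI[of _ i]) auto
      qed simp
      from less.hyps[OF this A] show ?thesis
        using less.prems(2) det kernel_mod_addrow[OF M ik(1-3)] by (simp add: A_def)
    next
      case False
      have "\<exists>i<Suc n. M $$ (i, 0) \<noteq> 0"
      proof (rule ccontr)
        assume "\<not> ?thesis"
        then have "det M = 0" by (subst laplace_expansion_column[OF M, of 0]) auto
        then show False using less.prems(2) \<open>q > 0\<close> by simp
      qed
      then obtain i where i: "i < Suc n" "M $$ (i, 0) \<noteq> 0" by blast
      have zero: "M $$ (k, 0) = 0" if "k < Suc n" "k \<noteq> i" for k
        using False i that linorder_linear[of "\<bar>M $$ (k, 0)\<bar>" "\<bar>M $$ (i, 0)\<bar>"] by blast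
      define g where "g = M $$ (i, 0)"
      define D where "D = mat_delete M i 0"
      have D: "D \<in> carrier_mat n n" using mat_delete_carrier[OF M] by (simp add: D_def)
      have "det M = (\<Sum>k<Suc n. M $$ (k, 0) * cofactor M k 0)"
        by (rule laplace_expansion_column[OF M]) simp
      also have "\<dots> = (\<Sum>k<Suc n. if k = i then g * cofactor M i 0 else 0)"
        using zero by (intro sum.cong) (auto simp: g_def)
      also have "\<dots> = g * cofactor M i 0" using i by simp
      finally have det: "det M = g * ((-1) ^ i * det D)" by (simp add: cofactor_def D_def)
      have dvd: "det D * g dvd q"
      proof -
        have "det D * g dvd det M" by (rule dvdI[of _ _ "(-1) ^ i"]) (simp add: det minus_one_power_iff)
        then show ?thesis using less.prems(2) dvd_trans by blast
      qed
      then have "det D dvd q" "g dvd q" by (auto elim: dvd_mult_left dvd_mult_right)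
      then have "det D \<noteq> 0" using \<open>q > 0\<close> by auto
      \<comment> \<open>Since \<open>det D * g\<close> divides \<open>q\<close>, every entry of
        \<open>xs\<close> is a multiple of \<open>g\<close>; the pivot equation is therefore
        solvable.\<close>
      have fibre: "card {x \<in> {0..<q}. q dvd g * x + (\<Sum>j<n. M $$ (i, Suc j) * xs ! j)} = nat \<bar>g\<bar>"
        if "xs \<in> kernel_mod q n D" for xs
      proof -
        have "g dvd (\<Sum>j<n. M $$ (i, Suc j) * xs ! j)"
          using kernel_mod_dvd[OF D dvd \<open>det D \<noteq> 0\<close> that] by (intro dvd_sum) simp
        then obtain t where t: "(\<Sum>j<n. M $$ (i, Suc j) * xs ! j) = g * t" by blast
        have "q dvd g * x + g * t \<longleftrightarrow> q dvd g * (- t - x)" for x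
          by (metis (no_types, opaque_lifting) add.commute dvd_minus_iff minus_add_distrib
              diff_conv_add_uminus minus_minus mult_minus_right distrib_left)
        moreover have "card {x \<in> {0..<q}. q dvd g * (- t - x)} = nat \<bar>g\<bar>"
          by (rule card_dvd_mult_coprime[where k = "sgn g"])
            (use \<open>q > 0\<close> \<open>g dvd q\<close> i in \<open>auto simp: g_def sgn_if\<close>)
        ultimately show ?thesis using t by simp
      qed
      have "kernel_mod q (Suc n) M = (\<lambda>(xs, x). x # xs) ` (SIGMA xs : kernel_mod q n D.
          {x \<in> {0..<q}. q dvd g * x + (\<Sum>j<n. M $$ (i, Suc j) * xs ! j)})"
        unfolding D_def g_def using M i(1) zero by (rule kernel_mod_pivot)
      then have "card (kernel_mod q (Suc n) M) = card (SIGMA xs : kernel_mod q n D.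
          {x \<in> {0..<q}. q dvd g * x + (\<Sum>j<n. M $$ (i, Suc j) * xs ! j)})"
        by (auto simp: inj_on_def intro!: card_image)
      also have "\<dots> = (\<Sum>xs\<in>kernel_mod q n D. nat \<bar>g\<bar>)"
        by (subst card_SigmaI) (simp_all add: fibre del: atLeastLessThan_iff)
      finally show ?thesis using IH[OF D \<open>det D dvd q\<close>]
        by (simp add: det abs_mult power_abs)
    qed
  qed
qed

section \<open>The determinant counts colourings\<close>

fun fresh_labels :: "slice list \<Rightarrow> nat" where
  "fresh_labels [] = 0"
| "fresh_labels (Slice a Cup b # w) = fresh_labels w"
| "fresh_labels (Slice a g b # w) = Suc (fresh_labels w)"

text \<open>A maximum adds two strands and one label, a minimum removes two strands and gives one
  relation, a crossing brings one label and one relation.\<close>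

lemma length_colouring_rows:
  "tangle m w n \<Longrightarrow> m + 2 * fresh_labels w = n + 2 * length (colouring_rows c ls w)"
proof (induction c ls w arbitrary: m rule: colouring_rows.induct)
qed (auto, fastforce+)

definition row_value :: "(nat \<Rightarrow> int) \<Rightarrow> int list \<Rightarrow> int" where
  "row_value r z = (\<Sum>j<length z. r j * z ! j)"

lemma row_value_Cup:
  assumes "i < length z" "k < length z"
  shows "row_value (\<lambda>j. label i j - label k j) z = z ! i - z ! k"
  using assms by (simp add: row_value_def label_def left_diff_distrib sum_subtractf if_distrib[of "\<lambda>x. x * _"] cong: if_cong)

lemma row_value_Cross:
  assumes "i < length z" "k < length z" "l < length z"
  shows "row_value (\<lambda>j. 2 * label i j - label k j - label l j) z = 2 * z ! i - z ! k - z ! l"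
proof -
  have "row_value (\<lambda>j. 2 * label i j - label k j - label l j) z =
     row_value (\<lambda>j. label i j - label k j) z + row_value (\<lambda>j. label i j - label l j) z"
    by (simp add: row_value_def algebra_simps flip: sum.distrib)
  then show ?thesis using assms by (simp add: row_value_Cup)
qed

text \<open>Two ways of bookkeeping are compared: \<open>colourings\<close> computes the colour
  leaving a crossing, while the determinant treats it as a new unknown tied down by a row. The row
  fixes that unknown modulo \<open>q\<close>, so the counts agree. Here \<open>ps\<close> holds the
  values of the labels already introduced and \<open>ys\<close> those still to come.\<close>

lemma colourings_labels:
  assumes "set ls \<subseteq> {..<length ps}" "tangle (length ls) w n" "q > 0"
  shows "colourings q (map ((!) ps) ls) w = card {ys \<in> vectors q (fresh_labels w).
    \<forall>r\<in>set (colouring_rows (length ps) ls w). q dvd row_value r (ps @ ys)}"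
  using assms(1,2)
proof (induction w arbitrary: ps ls)
  case Nil
  have "{ys. ys = [] \<and> P ys} = (if P [] then {[]} else {})" for P :: "int list \<Rightarrow> bool" by auto
  then show ?case by simp
next
  case (Cons x w)
  obtain a g b where x: "x = Slice a g b" by (cases x)
  with Cons.prems(2) have l: "length ls = a + upper_ends g + b"
    and t: "tangle (a + lower_ends g + b) w n" by auto
  from l obtain js us ks where ls: "ls = js @ us @ ks" "length js = a" "length us = upper_ends g"
    "length ks = b" by (rule list_split3)
  have bound: "i < length ps" if "i \<in> set ls" for i using Cons.prems(1) that by auto
  have ext: "map ((!) (ps @ [v])) js = map ((!) ps) js" "map ((!) (ps @ [v])) ks = map ((!) ps) ks" for v
    using bound ls(1) by (auto simp: nth_append)
  let ?p = "\<lambda>i. ps ! i" and ?c = "length ps"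
  show ?case
  proof (cases g)
    case Cap
    then have us: "us = []" using ls by simp
    have IH: "colourings q (map ?p js @ [v, v] @ map ?p ks) w =
       card {ys \<in> vectors q (fresh_labels w). \<forall>r\<in>set (colouring_rows (Suc ?c) (js @ [?c, ?c] @ ks) w).
          q dvd row_value r (ps @ v # ys)}" for v
    proof -
      have "set (js @ [?c, ?c] @ ks) \<subseteq> {..<length (ps @ [v])}"
        using bound ls(1) by (auto simp: less_Suc_eq)
      then have "colourings q (map ((!) (ps @ [v])) (js @ [?c, ?c] @ ks)) w = card {ys \<in> vectors q (fresh_labels w).
        \<forall>r\<in>set (colouring_rows (length (ps @ [v])) (js @ [?c, ?c] @ ks) w). q dvd row_value r ((ps @ [v]) @ ys)}"
        using Cons.IH[of "js @ [?c, ?c] @ ks" "ps @ [v]"] ls t Cap by simp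
      then show ?thesis using ext by (simp add: nth_append)
    qed
    have "colourings q (map ?p ls) (x # w) = (\<Sum>v\<in>{0..<q}. colourings q (map ?p js @ [v, v] @ map ?p ks) w)"
      using ls us by (simp add: x Cap)
    then show ?thesis unfolding IH using ls us by (simp add: x Cap card_vectors_Suc)
  next
    case Cup
    then obtain i k where us: "us = [i, k]" using ls by (auto simp: length_2_conv)
    have ik: "i < ?c" "k < ?c" using bound ls us by auto
    have row: "row_value (\<lambda>j. label i j - label k j) (ps @ ys) = ps ! i - ps ! k" for ys
      using row_value_Cup[of i "ps @ ys" k] ik by (simp add: nth_append)
    have "colourings q (map ?p ls) (x # w) =
       (if q dvd ps ! i - ps ! k then colourings q (map ?p (js @ ks)) w else 0)"
      using ls us by (simp add: x Cup)
    also have "colourings q (map ?p (js @ ks)) w = card {ys \<in> vectors q (fresh_labels w).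
        \<forall>r\<in>set (colouring_rows ?c (js @ ks) w). q dvd row_value r (ps @ ys)}"
      by (rule Cons.IH) (use bound ls t Cup in auto)
    finally show ?thesis using ls us row by (simp add: x Cup nth_append)
  next
    case (Cross s)
    then obtain i k where us: "us = [i, k]" using ls by (auto simp: length_2_conv)
    have ik: "i < ?c" "k < ?c" using bound ls us by auto
    define over where "over = (if s then i else k)"
    define under where "under = (if s then k else i)"
    define new where "new v = (if s then [v, ps ! i] else [ps ! k, v])" for v
    define new' where "new' = (if s then [?c, i] else [k, ?c])"
    have ou: "over < ?c" "under < ?c" using ik by (simp_all add: over_def under_def)
    have row: "row_value (\<lambda>j. 2 * label over j - label under j - label ?c j) (ps @ v # ys) =
        2 * ps ! over - ps ! under - v" for v ys
      using row_value_Cross[of over "ps @ v # ys" under ?c] ou by (simp add: nth_append)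
    have IH: "colourings q (map ?p js @ new v @ map ?p ks) w =
       card {ys \<in> vectors q (fresh_labels w). \<forall>r\<in>set (colouring_rows (Suc ?c) (js @ new' @ ks) w).
          q dvd row_value r (ps @ v # ys)}" for v
    proof -
      have "set (js @ new' @ ks) \<subseteq> {..<length (ps @ [v])}"
        using bound ls(1) ik by (auto simp: less_Suc_eq new'_def split: if_splits)
      then have "colourings q (map ((!) (ps @ [v])) (js @ new' @ ks)) w = card {ys \<in> vectors q (fresh_labels w).
        \<forall>r\<in>set (colouring_rows (length (ps @ [v])) (js @ new' @ ks) w). q dvd row_value r ((ps @ [v]) @ ys)}"
        using Cons.IH[of "js @ new' @ ks" "ps @ [v]"] ls t Cross by (simp add: new'_def)
      then show ?thesis using ext ik by (simp add: nth_append new_def new'_def split: if_splits)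
    qed
    have rows: "colouring_rows ?c ls (x # w) = (\<lambda>j. 2 * label over j - label under j - label ?c j)
        # colouring_rows (Suc ?c) (js @ new' @ ks) w"
      using ls us by (cases s) (simp_all add: x Cross over_def under_def new'_def nth_append)
    have "colourings q (map ?p ls) (x # w) =
        colourings q (map ?p js @ new (2 * ps ! over - ps ! under) @ map ?p ks) w"
      using ls us by (cases s) (simp_all add: x Cross over_def under_def new_def)
    also have "\<dots> = (\<Sum>v\<in>{0..<q}. if q dvd 2 * ps ! over - ps ! under - v
        then colourings q (map ?p js @ new v @ map ?p ks) w else 0)"
    proof (rule sum_congruent_delta[OF \<open>q > 0\<close>, symmetric], rule colourings_congruent[where n = n])
      fix v assume "q dvd 2 * ps ! over - ps ! under - v"
      then have "congruent_lists q (new v) (new (2 * ps ! over - ps ! under))"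
        by (simp add: new_def dvd_diff_commute)
      then show "congruent_lists q (map ?p js @ new v @ map ?p ks)
          (map ?p js @ new (2 * ps ! over - ps ! under) @ map ?p ks)"
        by (intro list_all2_appendI) auto
    qed (use ls t Cross in \<open>simp add: new_def\<close>)
    also have "\<dots> = card {ys \<in> vectors q (fresh_labels (x # w)).
        \<forall>r\<in>set (colouring_rows ?c ls (x # w)). q dvd row_value r (ps @ ys)}"
      unfolding IH rows by (simp add: x Cross card_vectors_Suc row) (rule sum.cong, auto)
    finally show ?thesis .
  qed
qed

text \<open>The coefficients 2, -1, -1 and 1, -1 cancel, even if labels coincide. Hence all colours
  may be translated by a constant, which allows one label to be normalised to 0.\<close>

lemma colouring_rows_sum:
  assumes "set ls \<subseteq> {..<c}" "tangle (length ls) w n" "r \<in> set (colouring_rows c ls w)"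
    "c + fresh_labels w \<le> N"
  shows "(\<Sum>j<N. r j) = 0"
proof -
  have label: "(\<Sum>j<N. label i j) = 1" if "i < N" for i using that by (simp add: label_def)
  show ?thesis using assms
  proof (induction w arbitrary: c ls)
    case (Cons x w)
    obtain a g b where x: "x = Slice a g b" by (cases x)
    with Cons.prems(2) have l: "length ls = a + upper_ends g + b"
      and t: "tangle (a + lower_ends g + b) w n" by auto
    have b: "i < c" if "i \<in> set ls" for i using Cons.prems(1) that by auto
    then have b': "ls ! i < c" if "i < length ls" for i using that by simp
    have td: "set (take a ls) \<subseteq> {..<c}" "set (drop k ls) \<subseteq> {..<c}"
      "set (take a ls) \<subseteq> {..<Suc c}" "set (drop k ls) \<subseteq> {..<Suc c}" for k
      using b by (auto dest!: in_set_dropD in_set_takeD simp: less_Suc_eq)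
    show ?case
    proof (cases g)
      case Cap
      with Cons.prems show ?thesis
        using Cons.IH[of "take a ls @ [c, c] @ drop a ls" "Suc c"] t l td
        by (auto simp: x subset_iff less_Suc_eq)
    next
      case Cup
      then have "r = (\<lambda>j. label (ls ! a) j - label (ls ! Suc a) j) \<or>
        r \<in> set (colouring_rows c (take a ls @ drop (a + 2) ls) w)" using Cons.prems by (simp add: x)
      then show ?thesis
      proof
        assume "r = (\<lambda>j. label (ls ! a) j - label (ls ! Suc a) j)"
        then show ?thesis using b'[of a] b'[of "Suc a"] l Cup Cons.prems(4) by (simp add: sum_subtractf label)
      next
        assume "r \<in> set (colouring_rows c (take a ls @ drop (a + 2) ls) w)"
        then show ?thesis using Cons.IH[of "take a ls @ drop (a + 2) ls" c] t l td Cup Cons.prems(4)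
          by (auto simp: x)
      qed
    next
      case (Cross s)
      define over where "over = ls ! (if s then a else Suc a)"
      define under where "under = ls ! (if s then Suc a else a)"
      define new where "new = (if s then [c, ls ! a] else [ls ! Suc a, c])"
      have lt: "ls ! a < c" "ls ! Suc a < c" using b'[of a] b'[of "Suc a"] l Cross by simp_all
      have "r = (\<lambda>j. 2 * label over j - label under j - label c j) \<or>
        r \<in> set (colouring_rows (Suc c) (take a ls @ new @ drop (a + 2) ls) w)"
        using Cons.prems(3) by (cases s) (simp_all add: x Cross over_def under_def new_def)
      then show ?thesis
      proof
        assume "r = (\<lambda>j. 2 * label over j - label under j - label c j)"
        then show ?thesis using lt Cross Cons.prems(4)
          by (simp add: x sum_subtractf label over_def under_def flip: sum_distrib_left)
      next
        assume "r \<in> set (colouring_rows (Suc c) (take a ls @ new @ drop (a + 2) ls) w)"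
        then show ?thesis
          using Cons.IH[of "take a ls @ new @ drop (a + 2) ls" "Suc c"] t l td lt Cross Cons.prems(4)
          by (cases s) (auto simp: x new_def)
      qed
    qed
  qed simp
qed

text \<open>
  The alternating sum of the colours along a horizontal line changes at every slice by plus or minus
  the value of the row of that slice, so the last row is redundant.
\<close>

fun alternating_sum :: "int list \<Rightarrow> int" where
  "alternating_sum [] = 0"
| "alternating_sum (x # xs) = x - alternating_sum xs"

lemma alternating_sum_append:
  "alternating_sum (xs @ ys) = alternating_sum xs + (-1) ^ length xs * alternating_sum ys"
  by (induction xs) (auto simp: algebra_simps)

lemma dvd_last_row:
  assumes "set ls \<subseteq> {..<c}" "tangle (length ls) w 0" "length z = c + fresh_labels w"
    "colouring_rows c ls w \<noteq> []"
    "\<forall>r\<in>set (butlast (colouring_rows c ls w)). q dvd row_value r z"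
    "q dvd alternating_sum (map ((!) z) ls)"
  shows "q dvd row_value (last (colouring_rows c ls w)) z"
  using assms
proof (induction w arbitrary: c ls)
  case (Cons x w)
  obtain a g b where x: "x = Slice a g b" by (cases x)
  with Cons.prems(2) have l: "length ls = a + upper_ends g + b"
    and t: "tangle (a + lower_ends g + b) w 0" by auto
  from l obtain js us ks where ls: "ls = js @ us @ ks" "length js = a" "length us = upper_ends g"
    "length ks = b" by (rule list_split3)
  have bound: "i < c" if "i \<in> set ls" for i using Cons.prems(1) that by auto
  have step: ?case if rows: "colouring_rows c ls (x # w) = r # colouring_rows c' ls' w"
    and ls': "set ls' \<subseteq> {..<c'}" "length ls' = a + lower_ends g + b" "length z = c' + fresh_labels w"
    and alt: "alternating_sum (map ((!) z) ls) = alternating_sum (map ((!) z) ls') + e * row_value r z"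
    and e: "e \<in> {1, -1}" for r c' ls' e
  proof (cases "colouring_rows c' ls' w = []")
    case True
    \<comment> \<open>Strands still open would need a further minimum and hence a row. So the line
      is empty, its alternating sum is 0, and \<open>r\<close> itself is the last row.\<close>
    then have "ls' = []" using length_colouring_rows[OF t, of c' ls'] ls'(2) by simp
    then have "q dvd e * row_value r z" using alt Cons.prems(6) by simp
    then show ?thesis using rows True e by auto
  next
    case False
    then have r: "q dvd row_value r z" using Cons.prems(5) rows by simp
    then have "q dvd alternating_sum (map ((!) z) ls')"
      using Cons.prems(6) unfolding alt by (simp add: dvd_add_left_iff)
    then have "q dvd row_value (last (colouring_rows c' ls' w)) z"
      using Cons.IH[OF ls'(1) _ ls'(3) False] t ls'(2) Cons.prems(5) rows False by simp
    then show ?thesis using rows False by simp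
  qed
  show ?case
  proof (cases g)
    case Cap
    then have us: "us = []" using ls by simp
    have rows: "colouring_rows c ls (x # w) = colouring_rows (Suc c) (js @ [c, c] @ ks) w"
      using ls us by (simp add: x Cap)
    show ?thesis unfolding rows
    proof (rule Cons.IH)
      show "set (js @ [c, c] @ ks) \<subseteq> {..<Suc c}" using bound ls by (auto simp: less_Suc_eq)
    qed (use Cons.prems rows ls us t Cap in \<open>auto simp: x alternating_sum_append\<close>)
  next
    case Cup
    then obtain i k where us: "us = [i, k]" using ls by (auto simp: length_2_conv)
    have ik: "i < c" "k < c" using bound ls us by auto
    show ?thesis
    proof (rule step)
      show "colouring_rows c ls (x # w) = (\<lambda>j. label i j - label k j) # colouring_rows c (js @ ks) w"
        using ls us by (simp add: x Cup nth_append)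
      show "set (js @ ks) \<subseteq> {..<c}" using bound ls by auto
      show "alternating_sum (map ((!) z) ls) = alternating_sum (map ((!) z) (js @ ks)) +
          (-1) ^ a * row_value (\<lambda>j. label i j - label k j) z"
        using ls us ik Cons.prems(3) by (simp add: alternating_sum_append row_value_Cup algebra_simps)
    qed (use Cons.prems(3) ls Cup in \<open>auto simp: x minus_one_power_iff\<close>)
  next
    case (Cross s)
    then obtain i k where us: "us = [i, k]" using ls by (auto simp: length_2_conv)
    have ik: "i < c" "k < c" using bound ls us by auto
    define r where "r = (if s then (\<lambda>j. 2 * label i j - label k j - label c j)
        else (\<lambda>j. 2 * label k j - label i j - label c j))"
    define new where "new = (if s then [c, i] else [k, c])"
    have row: "row_value r z = (if s then 2 * z ! i - z ! k - z ! c else 2 * z ! k - z ! i - z ! c)"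
      using ik Cons.prems(3) by (simp add: r_def row_value_Cross x Cross)
    show ?thesis
    proof (rule step)
      show "colouring_rows c ls (x # w) = r # colouring_rows (Suc c) (js @ new @ ks) w"
        using ls us by (cases s) (simp_all add: x Cross nth_append r_def new_def)
      show "set (js @ new @ ks) \<subseteq> {..<Suc c}"
        using bound ls ik by (auto simp: new_def less_Suc_eq split: if_splits)
      show "alternating_sum (map ((!) z) ls) = alternating_sum (map ((!) z) (js @ new @ ks)) +
          (if s then (-1) ^ a else - ((-1) ^ a)) * row_value r z"
        using ls us ik Cons.prems(3)
        by (simp add: x Cross alternating_sum_append algebra_simps row new_def)
    qed (use Cons.prems(3) ls Cross in \<open>auto simp: x new_def minus_one_power_iff\<close>)
  qed
qed simp

lemma row_value_shift:
  assumes "(\<Sum>j<length z. r j) = 0"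
  shows "q dvd row_value r (map (\<lambda>x. (x + t) mod q) z) \<longleftrightarrow> q dvd row_value r z"
proof -
  have "row_value r (map (\<lambda>x. (x + t) mod q) z) =
      (\<Sum>j<length z. r j * (z ! j + t) - q * (r j * ((z ! j + t) div q)))"
    unfolding row_value_def by (intro sum.cong) (auto simp: minus_div_mult_eq_mod[symmetric] algebra_simps)
  also have "\<dots> = row_value r z + (\<Sum>j<length z. r j) * t - q * (\<Sum>j<length z. r j * ((z ! j + t) div q))"
    by (simp add: row_value_def sum_subtractf sum.distrib distrib_left sum_distrib_right sum_distrib_left)
  finally show ?thesis using assms by (simp add: dvd_diff_left_iff)
qed

definition colouring_matrix :: "slice list \<Rightarrow> int mat" where
  "colouring_matrix w = (let rows = colouring_rows 0 [] w; n = length rows - 1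
     in mat n n (\<lambda>(i, j). (rows ! i) j))"

lemma colouring_matrix_carrier:
  "colouring_matrix w \<in> carrier_mat (fresh_labels w - 1) (fresh_labels w - 1)" if "link_diagram w"
  using length_colouring_rows[of 0 w 0 0 "[]"] that
  by (simp add: colouring_matrix_def Let_def link_diagram_def)

lemma diagram_determinant_eq: "diagram_determinant w = \<bar>det (colouring_matrix w)\<bar>"
  by (simp add: diagram_determinant_def colouring_matrix_def Let_def)

text \<open>The last row follows from the others, and a translation moves the colour of the last
  label to 0. A colouring therefore corresponds to that colour, which gives the factor
  \<open>q\<close>, and a solution of the square system without the last row and column.\<close>

lemma colourings_eq_kernel:
  assumes w: "link_diagram w" "w \<noteq> []" and "q > 0"
  shows "colourings q [] w = nat q * card (kernel_mod q (fresh_labels w - 1) (colouring_matrix w))"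
proof -
  define rows where "rows = colouring_rows 0 [] w"
  have t: "tangle 0 w 0" using w by (simp add: link_diagram_def)
  have len: "length rows = fresh_labels w" using length_colouring_rows[OF t] by (simp add: rows_def)
  obtain a g b v where "w = Slice a g b # v" using w(2) by (metis slice.exhaust neq_Nil_conv)
  then have "fresh_labels w \<noteq> 0" using t by (cases g) auto
  then obtain n where n: "fresh_labels w = Suc n" using not0_implies_Suc by blast
  have rows_ne: "rows \<noteq> []" using len n by auto
  define X where "X = {ys \<in> vectors q (Suc n). \<forall>r\<in>set rows. q dvd row_value r ys}"
  define Y where "Y = kernel_mod q n (colouring_matrix w)"
  have zero: "(\<Sum>j<length z. r j) = 0" if "r \<in> set rows" "length z = Suc n" for r and z :: "int list"
    using colouring_rows_sum[of "[]" 0 w 0 r "Suc n"] that t n by (simp add: rows_def)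
  have X: "ys \<in> X \<longleftrightarrow> ys \<in> vectors q (Suc n) \<and> (\<forall>i<n. q dvd row_value (rows ! i) ys)" for ys
  proof -
    have "q dvd row_value (last rows) ys"
      if "ys \<in> vectors q (Suc n)" "\<forall>r\<in>set (butlast rows). q dvd row_value r ys"
      using dvd_last_row[of "[]" 0 w ys q] that t n rows_ne by (simp add: rows_def vectors_def)
    moreover have "set rows = insert (last rows) (set (butlast rows))"
      using rows_ne by (metis append_butlast_last_id list.set(2) rotate1.simps(2) set_rotate1)
    moreover have "set (butlast rows) = (!) rows ` {0..<n}"
      using len n nth_image[of n rows] by (simp add: butlast_conv_take)
    ultimately show ?thesis by (auto simp: X_def)
  qed
  have Y: "xs \<in> Y \<longleftrightarrow> xs \<in> vectors q n \<and> (\<forall>i<n. q dvd row_value (rows ! i) (xs @ [0]))" for xs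
  proof -
    have "colouring_matrix w $$ (i, j) = (rows ! i) j" if "i < n" "j < n" for i j
      using that len n by (simp add: colouring_matrix_def Let_def flip: rows_def)
    then show ?thesis
      by (auto simp: Y_def kernel_mod_def vectors_def row_value_def nth_append)
  qed
  have "bij_betw (\<lambda>(t, xs). map (\<lambda>x. (x + t) mod q) (xs @ [0])) ({0..<q} \<times> Y) X"
  proof (rule bij_betw_byWitness[where f' = "\<lambda>ys. (last ys, butlast (map (\<lambda>x. (x + - last ys) mod q) ys))"])
    have *: "map (\<lambda>x. ((x + s) mod q + t) mod q) xs = xs" if "s + t = 0" "xs \<in> vectors q k" for s t xs k
    proof (rule map_idI)
      fix x assume "x \<in> set xs"
      then have "x mod q = x" using that(2) by (auto simp: vectors_def)
      then show "((x + s) mod q + t) mod q = x" using that(1) by (simp add: mod_add_left_eq add.assoc)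
    qed
    show "\<forall>p\<in>{0..<q} \<times> Y. (\<lambda>ys. (last ys, butlast (map (\<lambda>x. (x + - last ys) mod q) ys)))
        ((\<lambda>(t, xs). map (\<lambda>x. (x + t) mod q) (xs @ [0])) p) = p"
      using *[of t "- t" for t] by (auto simp: Y o_def)
    show "\<forall>ys\<in>X. (\<lambda>(t, xs). map (\<lambda>x. (x + t) mod q) (xs @ [0]))
        (last ys, butlast (map (\<lambda>x. (x + - last ys) mod q) ys)) = ys"
    proof
      fix ys assume "ys \<in> X"
      then have ys: "ys \<in> vectors q (Suc n)" by (simp add: X)
      then have "ys \<noteq> []" by (auto simp: vectors_def)
      then have "butlast (map (\<lambda>x. (x + - last ys) mod q) ys) @ [0] = map (\<lambda>x. (x + - last ys) mod q) ys"
        by (cases ys rule: rev_cases) auto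
      then have "map (\<lambda>x. (x + last ys) mod q) (butlast (map (\<lambda>x. (x + - last ys) mod q) ys) @ [0]) = ys"
        using *[OF _ ys, of "- last ys" "last ys"] by (simp only: map_map o_def)
      then show "(\<lambda>(t, xs). map (\<lambda>x. (x + t) mod q) (xs @ [0]))
        (last ys, butlast (map (\<lambda>x. (x + - last ys) mod q) ys)) = ys" by simp
    qed
    show "(\<lambda>(t, xs). map (\<lambda>x. (x + t) mod q) (xs @ [0])) ` ({0..<q} \<times> Y) \<subseteq> X"
    proof safe
      fix t xs assume "t \<in> {0..<q}" "xs \<in> Y"
      then have xs: "xs \<in> vectors q n" "\<forall>i<n. q dvd row_value (rows ! i) (xs @ [0])" by (simp_all add: Y)
      have "q dvd row_value (rows ! i) (map (\<lambda>x. (x + t) mod q) (xs @ [0]))" if "i < n" for i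
      proof -
        have "(\<Sum>j<length (xs @ [0]). (rows ! i) j) = 0"
          using xs(1) that len n by (intro zero) (simp_all add: vectors_def)
        then show ?thesis using row_value_shift xs(2) that by blast
      qed
      moreover have "map (\<lambda>x. (x + t) mod q) (xs @ [0]) \<in> vectors q (Suc n)"
        using xs(1) \<open>q > 0\<close> by (auto simp: vectors_def)
      ultimately show "map (\<lambda>x. (x + t) mod q) (xs @ [0]) \<in> X"
        unfolding X by blast
    qed
    show "(\<lambda>ys. (last ys, butlast (map (\<lambda>x. (x + - last ys) mod q) ys))) ` X \<subseteq> {0..<q} \<times> Y"
    proof safe
      fix ys assume "ys \<in> X"
      then have ys: "ys \<in> vectors q (Suc n)" "\<forall>i<n. q dvd row_value (rows ! i) ys" by (auto simp: X)
      then obtain xs t where e: "ys = xs @ [t]" by (cases ys rule: rev_cases) (auto simp: vectors_def)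
      show "last ys \<in> {0..<q}" using ys e by (auto simp: vectors_def)
      have "map (\<lambda>x. (x + - t) mod q) ys = map (\<lambda>x. (x + - t) mod q) xs @ [0]" by (simp add: e)
      moreover have "q dvd row_value (rows ! i) (map (\<lambda>x. (x + - t) mod q) ys)" if "i < n" for i
      proof -
        have "(\<Sum>j<length ys. (rows ! i) j) = 0"
          using ys(1) that len n by (intro zero) (simp_all add: vectors_def)
        then show ?thesis using row_value_shift ys(2) that by blast
      qed
      ultimately show "butlast (map (\<lambda>x. (x + - last ys) mod q) ys) \<in> Y"
        using ys \<open>q > 0\<close> e by (auto simp: Y vectors_def)
    qed
  qed
  then have "card X = card ({0..<q} \<times> Y)" by (metis bij_betw_same_card)
  moreover have "colourings q [] w = card X"
    using colourings_labels[of "[]" "[]" w 0 q] t n \<open>q > 0\<close> by (simp add: X_def rows_def)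
  ultimately show ?thesis using n by (simp add: Y_def)
qed

text \<open>
  With \<open>q\<close> a multiple of the determinant, the kernel modulo \<open>q\<close> has exactly \<open>\<bar>det\<bar>\<close> elements; the powers
  of two only serve to exclude a vanishing determinant.
\<close>

lemma diagram_determinant_from_colourings:
  assumes w: "link_diagram w" "w \<noteq> []" and "D > 0"
    and D: "\<And>q. q > 0 \<Longrightarrow> D dvd q \<Longrightarrow> colourings q [] w = nat (q * D)"
    and two: "\<And>k. colourings (2 ^ k) [] w = 2 ^ k"
  shows "diagram_determinant w = D"
proof -
  define n where "n = fresh_labels w - 1"
  define M where "M = colouring_matrix w"
  have M: "M \<in> carrier_mat n n" using colouring_matrix_carrier[OF w(1)] by (simp add: M_def n_def)
  note K = colourings_eq_kernel[OF w, folded n_def M_def]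
  \<comment> \<open>An integral null vector stays non-zero modulo a power of 2 exceeding the
    absolute value of one of its non-zero entries. This would give more colourings than the
    \<open>2 ^ k\<close> constant ones.\<close>
  have "det M \<noteq> 0"
  proof
    assume "det M = 0"
    then obtain v where v: "v \<in> carrier_vec n" "v \<noteq> 0\<^sub>v n" "M *\<^sub>v v = 0\<^sub>v n"
      using det_0_iff_vec_prod_zero[OF M] by blast
    then obtain i where i: "i < n" "v $ i \<noteq> 0" by (auto simp: vec_eq_iff)
    obtain k where k: "nat \<bar>v $ i\<bar> < 2 ^ k" using less_exp by blast
    define q :: int where "q = 2 ^ k"
    have "\<bar>v $ i\<bar> < q" using k by (simp add: q_def nat_less_iff)
    then have "\<not> q dvd v $ i" using dvd_imp_le_int[OF i(2), of q] by auto
    have "q > 0" by (simp add: q_def)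
    define xs where "xs = map (\<lambda>j. v $ j mod q) [0..<n]"
    have row: "q dvd (\<Sum>j<n. M $$ (l, j) * (v $ j mod q))" if "l < n" for l
    proof -
      have "(\<Sum>j<n. M $$ (l, j) * v $ j) = 0"
        using arg_cong[OF v(3), of "\<lambda>u. u $ l"] that M v(1) by (simp add: scalar_prod_def atLeast0LessThan)
      moreover have "(\<Sum>j<n. M $$ (l, j) * (v $ j mod q)) mod q = (\<Sum>j<n. M $$ (l, j) * v $ j) mod q"
        by (subst (1 2) mod_sum_eq[symmetric]) (simp add: mod_mult_right_eq)
      ultimately show ?thesis by (simp add: dvd_eq_mod_eq_0)
    qed
    have "xs \<in> kernel_mod q n M"
      using row \<open>q > 0\<close> by (auto simp: kernel_mod_def vectors_def xs_def)
    moreover have "replicate n 0 \<in> kernel_mod q n M"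
      using \<open>q > 0\<close> by (auto simp: kernel_mod_def vectors_def)
    moreover have "xs ! i \<noteq> replicate n 0 ! i"
      using i(1) \<open>\<not> q dvd v $ i\<close> by (simp add: xs_def dvd_eq_mod_eq_0)
    ultimately have "card (kernel_mod q n M) \<noteq> 1" by (metis card_1_singletonE singletonD)
    then show False using two[of k] K[OF \<open>q > 0\<close>] by (simp add: q_def nat_power_eq)
  qed
  \<comment> \<open>A multiple of both numbers, so that the assumed count and the kernel count apply
    to the same modulus.\<close>
  define q where "q = \<bar>det M\<bar> * D"
  have "q > 0" using \<open>det M \<noteq> 0\<close> \<open>D > 0\<close> by (simp add: q_def)
  have "nat (q * D) = nat q * card (kernel_mod q n M)"
    using D[OF \<open>q > 0\<close>] K[OF \<open>q > 0\<close>] by (simp add: q_def)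
  then have "nat q * nat D = nat q * card (kernel_mod q n M)"
    using \<open>q > 0\<close> by (simp add: nat_mult_distrib)
  then have "nat D = card (kernel_mod q n M)" using \<open>q > 0\<close> by simp
  then show ?thesis using card_kernel_mod[OF M, of q] \<open>q > 0\<close> \<open>D > 0\<close>
    by (simp add: q_def diagram_determinant_eq M_def)
qed

section \<open>Colourings of symmetric unions\<close>

text \<open>Reflection swaps left and right and negates the crossing, so the over strand stays over.
  Read from right to left, the right half therefore obeys the colouring rules of
  \<open>D\<close>.\<close>

lemma spread_reflect:
  assumes "length us = upper_ends g"
  shows "spread q (reflect_piece g) (rev us) F = spread q g us (\<lambda>vs. F (rev vs))"
proof (cases g)
  case (Cross s)
  then show ?thesis using assms by (cases s) (auto simp: length_2_conv)
qed (use assms in \<open>auto simp: length_2_conv dvd_diff_commute\<close>)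

lemma upper_ends_reflect [simp]: "upper_ends (reflect_piece g) = upper_ends g"
  by (cases g) auto

lemma colourings_symmetric_slice:
  assumes "length xs = a" "length us = upper_ends g" "length ys = b"
    and "length xs' = a" "length us' = upper_ends g" "length ys' = b"
  shows "colourings q ((xs @ us @ ys) @ rev (xs' @ us' @ ys')) (symmetric_union n (Half (Slice a g b) # E)) =
    spread q g us (\<lambda>vs. spread q g us' (\<lambda>vs'.
      colourings q ((xs @ vs @ ys) @ rev (xs' @ vs' @ ys')) (symmetric_union (a + lower_ends g + b) E)))"
proof -
  have 1: "(xs @ us @ ys) @ rev (xs' @ us' @ ys') = xs @ us @ (ys @ rev (xs' @ us' @ ys'))" by simp
  have "colourings q (xs @ vs @ (ys @ rev (xs' @ us' @ ys')))
      (Slice (a + lower_ends g + b + b) (reflect_piece g) a # w) =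
      spread q g us' (\<lambda>vs'. colourings q ((xs @ vs @ ys) @ rev (xs' @ vs' @ ys')) w)"
    if "length vs = lower_ends g" for vs w
    using colourings_slice[of "xs @ vs @ ys @ rev ys'" _ "rev us'" "reflect_piece g" q "rev xs'"]
      spread_reflect[of us' g] assms that by simp
  then show ?thesis unfolding 1 using assms
    by (simp only: symmetric_union.simps Let_def colourings_slice[OF assms(1,2)] cong: spread_cong)
qed

section \<open>Lower bound: doubled colourings\<close>

lemma spread_le_spread2:
  assumes "\<And>vs. length vs = lower_ends g \<Longrightarrow> F vs \<le> G vs vs"
  shows "spread q g us F \<le> spread q g us (\<lambda>vs. spread q g us (G vs))"
proof (cases g)
  case Cap
  have "F [c, c] \<le> (\<Sum>d\<in>{0..<q}. G [c, c] [d, d])" if "c \<in> {0..<q}" for c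
    using assms[of "[c, c]"] Cap member_le_sum[of c "{0..<q}" "\<lambda>d. G [c, c] [d, d]"] that by fastforce
  then show ?thesis using Cap by (auto intro: sum_mono)
next
  case (Cross s)
  then show ?thesis using assms by (cases s) auto
qed (use assms in auto)

text \<open>Both colours move by the same amount, so the difference across the axis survives the
  twist, and equal colours pass unchanged.\<close>

lemma colourings_axis_twist:
  "colourings q (xs @ x # y # zs) (axis_slices (length xs) (Twist n) @ w) =
   colourings q (xs @ (x + n * (x - y)) # (y + n * (x - y)) # zs) w"
proof -
  have "colourings q (xs @ x # y # zs) (replicate k (Slice (length xs) (Cross s) b) @ w) =
    colourings q (xs @ (x + (if s then 1 else -1) * int k * (x - y)) #
      (y + (if s then 1 else -1) * int k * (x - y)) # zs) w" for k s b
    by (induction k arbitrary: x y) (cases s; simp add: algebra_simps)+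
  then show ?thesis by (cases "n > 0") simp_all
qed

lemma colourings_axis_infinity:
  "colourings q (xs @ x # y # zs) (axis_slices (length xs) Infinity @ w) =
   (if q dvd x - y then \<Sum>c\<in>{0..<q}. colourings q (xs @ c # c # zs) w else 0)"
  by (simp add: nth_append)

text \<open>With the same colouring on both halves, the two strands at the axis have equal colours.
  A twist then has no effect, and at the \<open>Infinity\<close> disk the new pair may continue with
  the old colour.\<close>

lemma colourings_le_symmetric_union:
  assumes "q > 0" "tangle (length ls) (partial_diagram E) n" "disks_meet (length ls) E"
  shows "colourings q ls (partial_diagram E) \<le> colourings q (ls @ rev ls) (symmetric_union (length ls) E)"
  using assms(2,3)
proof (induction E arbitrary: ls)
  case (Cons i E)
  show ?case
  proof (cases i)
    case (Half x)
    obtain a g b where x: "x = Slice a g b" by (cases x)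
    with Cons.prems Half have l: "length ls = a + upper_ends g + b" by simp
    from l obtain xs us ys where ls: "ls = xs @ us @ ys" "length xs = a" "length us = upper_ends g"
      "length ys = b" by (rule list_split3)
    have "colourings q (xs @ vs @ ys) (partial_diagram E) \<le> colourings q ((xs @ vs @ ys) @ rev (xs @ vs @ ys))
       (symmetric_union (a + lower_ends g + b) E)" if "length vs = lower_ends g" for vs
      using Cons.IH[of "xs @ vs @ ys"] Cons.prems that ls by (simp add: Half x add.assoc)
    then show ?thesis
      unfolding Half x ls(1) partial_diagram.simps
        colourings_slice[OF ls(2,3)] colourings_symmetric_slice[OF ls(2-4) ls(2-4)]
      by (rule spread_le_spread2)
  next
    case (Disk t)
    with Cons.prems have "ls \<noteq> []" by auto
    then obtain xs x where ls: "ls = xs @ [x]" by (metis rev_exhaust)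
    have IH: "colourings q ls (partial_diagram E) \<le> colourings q (xs @ x # x # rev xs) (symmetric_union (length ls) E)"
      using Cons.IH[of ls] Cons.prems Disk ls by simp
    show ?thesis
    proof (cases t)
      case Infinity
      define F where "F c = colourings q (xs @ c # c # rev xs) (symmetric_union (length ls) E)" for c
      have x: "x mod q \<in> {0..<q}" using \<open>q > 0\<close> by simp
      \<comment> \<open>The colour of the new maximum ranges over \<open>{0..<q}\<close>, so
        \<open>x\<close> is replaced by its representative there, which selects one summand.\<close>
      have "colourings q ls (partial_diagram E) = colourings q (xs @ [x mod q]) (partial_diagram E)"
        by (rule colourings_congruent[where n = n])
          (use ls Cons.prems Disk in \<open>auto intro!: list_all2_appendI simp: minus_mod_eq_mult_div\<close>)
      also have "\<dots> \<le> F (x mod q)"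
        using Cons.IH[of "xs @ [x mod q]"] Cons.prems Disk ls by (simp add: F_def)
      also have "\<dots> \<le> (\<Sum>c\<in>{0..<q}. F c)" using x by (intro member_le_sum) auto
      finally show ?thesis using ls colourings_axis_infinity[of q xs x x "rev xs"]
        by (simp add: Disk Infinity F_def)
    next
      case (Twist k)
      then show ?thesis using IH ls colourings_axis_twist[of q xs x x "rev xs" k]
        by (simp add: Disk Twist del: axis_slices.simps)
    qed
  qed
qed simp

section \<open>Upper bound: colourings sorted by the difference of the two halves\<close>

fun choices :: "item list \<Rightarrow> nat" where
  "choices [] = 0"
| "choices (Half (Slice a Cap b) # E) = Suc (choices E)"
| "choices (Disk Infinity # E) = Suc (choices E)"
| "choices (_ # E) = choices E"

fun crossed :: "bool \<Rightarrow> int \<Rightarrow> int \<Rightarrow> int list" where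
  "crossed True x y = [2 * x - y, x]"
| "crossed False x y = [y, 2 * y - x]"

definition replace_strands :: "nat \<Rightarrow> nat \<Rightarrow> int list \<Rightarrow> int list \<Rightarrow> int list" where
  "replace_strands a k vs xs = take a xs @ vs @ drop (a + k) xs"

text \<open>
  The difference of the colours of the left half and of the reflected right half is a colouring \<open>ds\<close>
  of the partial diagram that vanishes at the \<open>Infinity\<close> disk.  Given its values \<open>es\<close> at the maxima,
  \<open>lifts\<close> counts the colourings of the left half; the entry of \<open>es\<close> for the \<open>Infinity\<close> disk is the
  jump of the left colour there.
\<close>

fun lifts :: "int \<Rightarrow> int list \<Rightarrow> int list \<Rightarrow> int list \<Rightarrow> item list \<Rightarrow> nat" where
  "lifts q ls ds es [] = 1"
| "lifts q ls ds es (Half (Slice a Cap b) # E) =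
     (\<Sum>c\<in>{0..<q}. lifts q (replace_strands a 0 [c, c] ls) (replace_strands a 0 [hd es, hd es] ds) (tl es) E)"
| "lifts q ls ds es (Half (Slice a Cup b) # E) =
     (if q dvd ls ! a - ls ! Suc a \<and> q dvd ds ! a - ds ! Suc a
      then lifts q (replace_strands a 2 [] ls) (replace_strands a 2 [] ds) es E else 0)"
| "lifts q ls ds es (Half (Slice a (Cross s) b) # E) =
     lifts q (replace_strands a 2 (crossed s (ls ! a) (ls ! Suc a)) ls)
       (replace_strands a 2 (crossed s (ds ! a) (ds ! Suc a)) ds) es E"
| "lifts q ls ds es (Disk (Twist n) # E) =
     lifts q (butlast ls @ [last ls + n * last ds]) ds es E"
| "lifts q ls ds es (Disk Infinity # E) =
     (if q dvd last ds then lifts q (butlast ls @ [last ls + hd es]) ds (tl es) E else 0)"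

abbreviation diff_lists :: "int list \<Rightarrow> int list \<Rightarrow> int list" where
  "diff_lists xs ys \<equiv> map2 (-) xs ys"

abbreviation well_formed :: "nat \<Rightarrow> item list \<Rightarrow> bool" where
  "well_formed n E \<equiv> tangle n (partial_diagram E) 0 \<and> disks_meet n E"

lemma length_replace_strands:
  "length xs = a + k + b \<Longrightarrow> length (replace_strands a k vs xs) = a + length vs + b"
  by (simp add: replace_strands_def)

lemma congruent_replace_strands:
  "congruent_lists q xs ys \<Longrightarrow> congruent_lists q us vs \<Longrightarrow> congruent_lists q (replace_strands a k us xs) (replace_strands a k vs ys)"
  unfolding replace_strands_def by (intro list_all2_appendI list_all2_takeI list_all2_dropI)

lemma diff_replace_strands:
  assumes "length xs = length ys" "length us = length vs"
  shows "diff_lists (replace_strands a k us xs) (replace_strands a k vs ys) = replace_strands a k (diff_lists us vs) (diff_lists xs ys)"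
  using assms by (simp add: replace_strands_def take_map drop_map take_zip drop_zip)

lemma crossed_length [simp]: "length (crossed s x y) = 2"
  by (cases s) auto

lemma crossed_diff: "diff_lists (crossed s x y) (crossed s x' y') = crossed s (x - x') (y - y')"
  by (cases s) auto

lemma congruent_crossed:
  assumes "q dvd x - x'" "q dvd y - y'"
  shows "congruent_lists q (crossed s x y) (crossed s x' y')"
proof -
  have "2 * x - y - (2 * x' - y') = 2 * (x - x') - (y - y')"
    "2 * y - x - (2 * y' - x') = 2 * (y - y') - (x - x')" by simp_all
  then have "q dvd 2 * x - y - (2 * x' - y')" "q dvd 2 * y - x - (2 * y' - x')"
    using assms by (metis dvd_diff dvd_mult)+
  then show ?thesis using assms by (cases s) auto
qed

lemma congruent_butlast_snoc:
  "congruent_lists q xs ys \<Longrightarrow> q dvd x - y \<Longrightarrow> congruent_lists q (butlast xs @ [x]) (butlast ys @ [y])"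
  by (frule list_all2_lengthD) (auto intro!: list_all2_appendI list_all2_takeI simp: butlast_conv_take)

lemma congruent_last:
  assumes "congruent_lists q xs ys" "xs \<noteq> []"
  shows "q dvd last xs - last ys"
  using assms(2) list_all2_lengthD[OF assms(1)] list_all2_nthD[OF assms(1), of "length xs - 1"]
  by (cases "ys = []") (auto simp: last_conv_nth)

lemma dvd_congruent: "q dvd x - (x'::int) \<Longrightarrow> q dvd x \<longleftrightarrow> q dvd x'"
  by (metis dvd_diff_left_iff dvd_diff_right_iff)

lemma dvd_congruent2: "q dvd x - (x'::int) \<Longrightarrow> q dvd y - y' \<Longrightarrow> q dvd x - y \<longleftrightarrow> q dvd x' - y'"
  by (rule dvd_congruent) (metis diff_diff_eq2 diff_add_eq dvd_diff add_diff_eq diff_diff_eq add.commute)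

lemma lifts_congruent:
  assumes "congruent_lists q ls ls'" "congruent_lists q ds ds'" "length ds = length ls"
    "well_formed (length ls) E"
  shows "lifts q ls ds es E = lifts q ls' ds' es E"
  using assms
proof (induction E arbitrary: ls ls' ds ds' es)
  case (Cons i E)
  note len = list_all2_lengthD[OF Cons.prems(1)] list_all2_lengthD[OF Cons.prems(2)]
  show ?case
  proof (cases i)
    case (Half x)
    obtain a g b where x: "x = Slice a g b" by (cases x)
    with Cons.prems Half have l: "length ls = a + upper_ends g + b"
      and wf: "well_formed (a + lower_ends g + b) E" by auto
    have nth: "q dvd ls ! j - ls' ! j" "q dvd ds ! j - ds' ! j" if "j < length ls" for j
      using Cons.prems that by (auto intro: list_all2_nthD)
    show ?thesis
    proof (cases g)
      case Cap
      then show ?thesis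
        using Cons.prems l wf by (auto simp: Half x length_replace_strands intro!: sum.cong Cons.IH congruent_replace_strands)
    next
      case Cup
      have "lifts q (replace_strands a 2 [] ls) (replace_strands a 2 [] ds) es E = lifts q (replace_strands a 2 [] ls') (replace_strands a 2 [] ds') es E"
        using Cons.prems l wf Cup by (auto simp: length_replace_strands intro!: Cons.IH congruent_replace_strands)
      moreover have "q dvd ls ! a - ls ! Suc a \<longleftrightarrow> q dvd ls' ! a - ls' ! Suc a"
        "q dvd ds ! a - ds ! Suc a \<longleftrightarrow> q dvd ds' ! a - ds' ! Suc a"
        using l Cup by (auto intro!: dvd_congruent2 nth)
      ultimately show ?thesis by (simp add: Half x Cup)
    next
      case (Cross s)
      then show ?thesis
        using Cons.prems l wf nth
        by (auto simp: Half x length_replace_strands intro!: Cons.IH congruent_replace_strands congruent_crossed)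
    qed
  next
    case (Disk t)
    then have ne: "ls \<noteq> []" "ds \<noteq> []" and wf: "well_formed (length ls) E" using Cons.prems by auto
    note last = congruent_last[OF Cons.prems(1) ne(1)] congruent_last[OF Cons.prems(2) ne(2)]
    show ?thesis
    proof (cases t)
      case Infinity
      have "lifts q (butlast ls @ [last ls + hd es]) ds (tl es) E = lifts q (butlast ls' @ [last ls' + hd es]) ds' (tl es) E"
        using Cons.prems wf ne last by (intro Cons.IH congruent_butlast_snoc) auto
      then show ?thesis using dvd_congruent[OF last(2)] by (simp add: Disk Infinity)
    next
      case (Twist k)
      have "last ls + k * last ds - (last ls' + k * last ds') = (last ls - last ls') + k * (last ds - last ds')"
        by (simp add: algebra_simps)
      then have "q dvd last ls + k * last ds - (last ls' + k * last ds')"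
        using last by (metis dvd_add dvd_mult)
      then show ?thesis using Cons.prems wf ne
        by (auto simp: Disk Twist intro!: Cons.IH congruent_butlast_snoc)
    qed
  qed
qed simp

lemma butlast_diff:
  "length xs = length ys \<Longrightarrow> butlast (diff_lists xs ys) = diff_lists (butlast xs) (butlast ys)"
  by (simp add: map_butlast[symmetric] butlast_conv_take take_map take_zip)

lemma last_diff:
  "length xs = length ys \<Longrightarrow> xs \<noteq> [] \<Longrightarrow> last (diff_lists xs ys) = last xs - last ys"
  by (cases xs rule: rev_cases; cases ys rule: rev_cases) auto

lemma hd_tl_diff:
  assumes "length xs = length ys" "xs \<noteq> []"
  shows "hd (diff_lists xs ys) = hd xs - hd ys" "tl (diff_lists xs ys) = diff_lists (tl xs) (tl ys)"
  using assms by (cases xs; cases ys; simp)+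

text \<open>Subtracting a fixed lift injects the lifts of one difference into those of another.\<close>

lemma lifts_le_diff:
  assumes "q > 0" "length ds = length ls" "length ls' = length ls" "length ds' = length ls"
    "well_formed (length ls) E" "length es = choices E" "length es' = choices E"
    "lifts q ls' ds' es' E > 0"
  shows "lifts q ls ds es E \<le> lifts q (diff_lists ls ls') (diff_lists ds ds') (diff_lists es es') E"
  using assms(2-)
proof (induction E arbitrary: ls ls' ds ds' es es')
  case (Cons i E)
  note len = Cons.prems(1-3)
  show ?case
  proof (cases i)
    case (Half x)
    obtain a g b where x: "x = Slice a g b" by (cases x)
    with Cons.prems Half have l: "length ls = a + upper_ends g + b"
      and wf: "well_formed (a + lower_ends g + b) E" by auto
    show ?thesis
    proof (cases g)
      case Cap
      then have es: "length es = Suc (choices E)" "length es' = Suc (choices E)"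
        using Cons.prems by (simp_all add: Half x)
      then have ne: "es \<noteq> []" by auto
      from Cons.prems(7) have "(\<Sum>c\<in>{0..<q}. lifts q (replace_strands a 0 [c, c] ls')
          (replace_strands a 0 [hd es', hd es'] ds') (tl es') E) \<noteq> 0"
        unfolding Half x Cap lifts.simps by (rule gr_implies_not0)
      \<comment> \<open>The fixed lift is never constructed: positivity of its count yields its
        colour \<open>c'\<close> at this maximum, together with positivity for the rest. Subtracting
        it shifts the summation variable by \<open>c'\<close>.\<close>
      then obtain c' where c': "lifts q (replace_strands a 0 [c', c'] ls')
          (replace_strands a 0 [hd es', hd es'] ds') (tl es') E > 0"
        by (meson sum.not_neutral_contains_not_neutral neq0_conv)
      define F where "F c = lifts q (replace_strands a 0 [c, c] (diff_lists ls ls'))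
        (diff_lists (replace_strands a 0 [hd es, hd es] ds) (replace_strands a 0 [hd es', hd es'] ds'))
        (diff_lists (tl es) (tl es')) E" for c
      have "lifts q (replace_strands a 0 [c, c] ls) (replace_strands a 0 [hd es, hd es] ds) (tl es) E \<le> F (c - c')" for c
      proof -
        have "replace_strands a 0 [c - c', c - c'] (diff_lists ls ls') =
            diff_lists (replace_strands a 0 [c, c] ls) (replace_strands a 0 [c', c'] ls')"
          using len by (subst diff_replace_strands) auto
        then show ?thesis unfolding F_def
          using Cons.IH[OF _ _ _ _ _ _ c', of "replace_strands a 0 [hd es, hd es] ds" "replace_strands a 0 [c, c] ls" "tl es"]
            len l wf es Cap by (simp add: length_replace_strands)
      qed
      then have "lifts q ls ds es (i # E) \<le> (\<Sum>c\<in>{0..<q}. F (c - c'))"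
        by (simp add: Half x Cap sum_mono)
      also have "\<dots> = (\<Sum>c\<in>{0..<q}. F c)"
      proof (rule sum_congruent_shift[OF \<open>q > 0\<close>])
        fix c d assume "q dvd c - d"
        then show "F c = F d" unfolding F_def
          using len l wf Cap by (intro lifts_congruent congruent_replace_strands) (auto simp: length_replace_strands)
      qed
      also have "\<dots> = lifts q (diff_lists ls ls') (diff_lists ds ds') (diff_lists es es') (i # E)"
        using len hd_tl_diff[of es es'] es ne by (simp add: F_def Half x Cap diff_replace_strands)
      finally show ?thesis .
    next
      case Cup
      show ?thesis
      proof (cases "lifts q ls ds es (i # E) = 0")
        case False
        then have 1: "q dvd ls ! a - ls ! Suc a" "q dvd ds ! a - ds ! Suc a"
          by (auto simp: Half x Cup split: if_splits)
        have 2: "q dvd ls' ! a - ls' ! Suc a" "q dvd ds' ! a - ds' ! Suc a"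
          "lifts q (replace_strands a 2 [] ls') (replace_strands a 2 [] ds') es' E > 0"
          using Cons.prems(7) by (auto simp: Half x Cup split: if_splits)
        have "q dvd (x - x') - (y - y')" if "q dvd x - y" "q dvd x' - y'" for x x' y y' :: int
          using dvd_diff[OF that] by (simp add: algebra_simps)
        note 3 = this[OF 1(1) 2(1)] this[OF 1(2) 2(2)]
        have "lifts q (replace_strands a 2 [] ls) (replace_strands a 2 [] ds) es E \<le>
            lifts q (replace_strands a 2 [] (diff_lists ls ls')) (replace_strands a 2 [] (diff_lists ds ds')) (diff_lists es es') E"
          using Cons.IH[OF _ _ _ _ _ _ 2(3), of "replace_strands a 2 [] ds" "replace_strands a 2 [] ls" es] Cons.prems(5,6)
            len l wf Cup by (simp add: length_replace_strands diff_replace_strands Half x)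
        then show ?thesis using 1 3 len l Cup by (simp add: Half x)
      qed simp
    next
      case (Cross s)
      show ?thesis
        using Cons.IH[of "replace_strands a 2 (crossed s (ds ! a) (ds ! Suc a)) ds"
            "replace_strands a 2 (crossed s (ls ! a) (ls ! Suc a)) ls"
            "replace_strands a 2 (crossed s (ls' ! a) (ls' ! Suc a)) ls'"
            "replace_strands a 2 (crossed s (ds' ! a) (ds' ! Suc a)) ds'" es es'] Cons.prems(5-7) len l wf
        by (simp add: length_replace_strands diff_replace_strands crossed_diff Half x Cross)
    qed
  next
    case (Disk t)
    then have ne: "ls \<noteq> []" "ds \<noteq> []" "ls' \<noteq> []" and wf: "well_formed (length ls) E"
      using Cons.prems by auto
    show ?thesis
    proof (cases t)
      case Infinity
      then have es: "length es = Suc (choices E)" "length es' = Suc (choices E)"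
        using Cons.prems by (simp_all add: Disk)
      then have nes: "es \<noteq> []" by auto
      show ?thesis
      proof (cases "lifts q ls ds es (i # E) = 0")
        case False
        then have 1: "q dvd last ds" by (auto simp: Disk Infinity split: if_splits)
        have 2: "q dvd last ds'" "lifts q (butlast ls' @ [last ls' + hd es']) ds' (tl es') E > 0"
          using Cons.prems(7) by (auto simp: Disk Infinity split: if_splits)
        show ?thesis
          using Cons.IH[OF _ _ _ _ _ _ 2(2), of ds "butlast ls @ [last ls + hd es]" "tl es"] 1 2(1) ne len wf es
          by (simp add: Disk Infinity last_diff butlast_diff hd_tl_diff nes algebra_simps)
      qed simp
    next
      case (Twist k)
      show ?thesis
        using Cons.IH[of ds "butlast ls @ [last ls + k * last ds]" "butlast ls' @ [last ls' + k * last ds']" ds' es es']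
          ne len wf Cons.prems(5-7)
        by (simp add: Disk Twist last_diff butlast_diff algebra_simps)
    qed
  qed
qed simp

text \<open>With zero difference the twists add nothing, and with zero jump the
  \<open>Infinity\<close> disk is invisible, so only the rules of the left half remain.\<close>

lemma lifts_zero:
  assumes "well_formed (length ls) E"
  shows "lifts q ls (replicate (length ls) 0) (replicate (choices E) 0) E = colourings q ls (partial_diagram E)"
  using assms
proof (induction E arbitrary: ls)
  case (Cons i E)
  show ?case
  proof (cases i)
    case (Half x)
    obtain a g b where x: "x = Slice a g b" by (cases x)
    with Cons.prems Half have l: "length ls = a + upper_ends g + b"
      and wf: "well_formed (a + lower_ends g + b) E" by auto
    have zero: "replace_strands a (upper_ends g) (replicate (length vs) 0) (replicate (length ls) 0) =
        replicate (length (replace_strands a (upper_ends g) vs ls)) 0" for vs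
      using l by (simp add: replace_strands_def replicate_add)
    have nth: "take 2 (drop a ls) ! 0 = ls ! a" "take 2 (drop a ls) ! Suc 0 = ls ! Suc a"
 if "upper_ends g = 2"
      using l that by auto
    have nth0: "replicate (length ls) (0::int) ! a = 0" "replicate (length ls) (0::int) ! Suc a = 0"
      if "upper_ends g = 2"
      by (rule nth_replicate, use l that in simp)+
    have IH: "lifts q (replace_strands a (upper_ends g) vs ls)
        (replace_strands a (upper_ends g) (replicate (length vs) 0) (replicate (length ls) 0)) (replicate (choices E) 0) E
      = colourings q (replace_strands a (upper_ends g) vs ls) (partial_diagram E)" if "length vs = lower_ends g" for vs
      unfolding zero by (rule Cons.IH) (use wf that in \<open>simp add: length_replace_strands[OF l]\<close>)
    have col: "colourings q ls (Slice a g b # w) = spread q g (take (upper_ends g) (drop a ls))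
        (\<lambda>vs. colourings q (replace_strands a (upper_ends g) vs ls) w)" for w
      by (simp add: replace_strands_def)
    show ?thesis unfolding Half x partial_diagram.simps col
    proof (cases g)
      case Cap
      then show "lifts q ls (replicate (length ls) 0) (replicate (choices (Half (Slice a g b) # E)) 0)
        (Half (Slice a g b) # E) = spread q g (take (upper_ends g) (drop a ls))
        (\<lambda>vs. colourings q (replace_strands a (upper_ends g) vs ls) (partial_diagram E))"
        using IH[of "[c, c]" for c] by (simp add: numeral_2_eq_2)
    next
      case Cup
      then show "lifts q ls (replicate (length ls) 0) (replicate (choices (Half (Slice a g b) # E)) 0)
        (Half (Slice a g b) # E) = spread q g (take (upper_ends g) (drop a ls))
        (\<lambda>vs. colourings q (replace_strands a (upper_ends g) vs ls) (partial_diagram E))"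
        using IH[of "[]"] nth nth0 by simp
    next
      case (Cross s)
      then show "lifts q ls (replicate (length ls) 0) (replicate (choices (Half (Slice a g b) # E)) 0)
        (Half (Slice a g b) # E) = spread q g (take (upper_ends g) (drop a ls))
        (\<lambda>vs. colourings q (replace_strands a (upper_ends g) vs ls) (partial_diagram E))"
        using IH[of "crossed s (ls ! a) (ls ! Suc a)"] nth nth0
        by (cases s) (simp_all add: numeral_2_eq_2)
    qed
  next
    case (Disk t)
    then have "ls \<noteq> []" using Cons.prems by auto
    then show ?thesis using Cons.IH[of ls] Cons.prems by (cases t) (simp_all add: Disk)
  qed
qed simp

text \<open>If some lift over \<open>es\<close> exists, subtracting it carries the lifts over
  \<open>es\<close> to lifts of the zero difference, and these are the colourings of
  \<open>D\<close>.\<close>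

lemma lifts_le_colourings:
  assumes "q > 0" "well_formed 0 E" "length es = choices E"
  shows "lifts q [] [] es E \<le> colourings q [] (partial_diagram E)"
proof (cases "lifts q [] [] es E = 0")
  case False
  have "diff_lists es es = replicate (length es) 0" by (induction es) auto
  then show ?thesis using lifts_le_diff[of q "[]" "[]" "[]" "[]" E es es] lifts_zero[of "[]" E q] assms False
    by simp
qed simp

text \<open>In a liftable \<open>es\<close> the entries at the maxima give a colouring of
  \<open>D\<close>, because the conditions on \<open>ds\<close> include its colouring conditions;
  the jump at each \<open>Infinity\<close> disk is free and costs a factor \<open>q\<close>. The
  left colours are quantified away since only differences are counted.\<close>

lemma sum_liftable_le:
  assumes "q > 0" "tangle (length ds) (partial_diagram E) n"
  shows "(\<Sum>es\<in>vectors q (choices E). if \<exists>ls. lifts q ls ds es E > 0 then 1 else 0) \<le>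
    nat q ^ length (filter (\<lambda>x. x = Disk Infinity) E) * colourings q ds (partial_diagram E)"
  using assms(2)
proof (induction E arbitrary: ds)
  case (Cons i E)
  let ?N = "nat q ^ length (filter (\<lambda>x. x = Disk Infinity) E)"
  define G where "G ds = (\<Sum>es\<in>vectors q (choices E). if \<exists>ls. lifts q ls ds es E > 0 then 1 else (0::nat))" for ds
  note IH = Cons.IH[folded G_def]
  show ?case
  proof (cases i)
    case (Half x)
    obtain a g b where x: "x = Slice a g b" by (cases x)
    with Cons.prems Half have l: "length ds = a + upper_ends g + b"
      and t: "tangle (a + lower_ends g + b) (partial_diagram E) n" by auto
    have nth: "take 2 (drop a ds) ! 0 = ds ! a" "take 2 (drop a ds) ! Suc 0 = ds ! Suc a" if "upper_ends g = 2"
      using l that by auto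
    have IH': "G (replace_strands a (upper_ends g) vs ds) \<le> ?N * colourings q (replace_strands a (upper_ends g) vs ds) (partial_diagram E)"
      if "length vs = lower_ends g" for vs
      using IH[of "replace_strands a (upper_ends g) vs ds"] t that by (simp add: length_replace_strands[OF l])
    show ?thesis
    proof (cases g)
      case Cap
      have "(\<Sum>es\<in>vectors q (choices (i # E)). if \<exists>ls. lifts q ls ds es (i # E) > 0 then 1 else 0) \<le>
          (\<Sum>d\<in>{0..<q}. G (replace_strands a 0 [d, d] ds))"
        unfolding G_def by (simp add: Half x Cap sum_vectors_Suc) (intro sum_mono, auto)
      also have "\<dots> \<le> (\<Sum>d\<in>{0..<q}. ?N * colourings q (replace_strands a 0 [d, d] ds) (partial_diagram E))"
        using IH' Cap by (intro sum_mono) simp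
      finally show ?thesis by (simp add: Half x Cap replace_strands_def sum_distrib_left)
    next
      case Cup
      have "(\<Sum>es\<in>vectors q (choices (i # E)). if \<exists>ls. lifts q ls ds es (i # E) > 0 then 1 else 0) \<le>
          (if q dvd ds ! a - ds ! Suc a then G (replace_strands a 2 [] ds) else 0)"
        unfolding G_def by (auto simp: Half x Cup intro!: sum_mono)
      also have "\<dots> \<le> ?N * colourings q ds (partial_diagram (i # E))"
        using IH'[of "[]"] Cup nth by (simp add: Half x replace_strands_def)
      finally show ?thesis by (simp add: Half)
    next
      case (Cross s)
      have "(\<Sum>es\<in>vectors q (choices (i # E)). if \<exists>ls. lifts q ls ds es (i # E) > 0 then 1 else 0) \<le>
          G (replace_strands a 2 (crossed s (ds ! a) (ds ! Suc a)) ds)"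
        unfolding G_def by (auto simp: Half x Cross intro!: sum_mono)
      also have "\<dots> \<le> ?N * colourings q ds (partial_diagram (i # E))"
        using IH'[of "crossed s (ds ! a) (ds ! Suc a)"] Cross nth by (cases s) (simp_all add: Half x replace_strands_def)
      finally show ?thesis by (simp add: Half)
    qed
  next
    case (Disk t)
    show ?thesis
    proof (cases t)
      case Infinity
      have "(\<Sum>es\<in>vectors q (choices (i # E)). if \<exists>ls. lifts q ls ds es (i # E) > 0 then 1 else 0) \<le>
          (\<Sum>d\<in>{0..<q}. G ds)"
        unfolding G_def by (simp only: Disk Infinity choices.simps sum_vectors_Suc) (intro sum_mono, auto)
      also have "\<dots> = nat q * G ds" using \<open>q > 0\<close> by simp
      also have "\<dots> \<le> nat q * (?N * colourings q ds (partial_diagram E))"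
        using IH[of ds] Cons.prems Disk by simp
      finally show ?thesis by (simp add: Disk Infinity mult.assoc)
    next
      case (Twist k)
      have "(\<Sum>es\<in>vectors q (choices (i # E)). if \<exists>ls. lifts q ls ds es (i # E) > 0 then 1 else 0) \<le> G ds"
        unfolding G_def by (auto simp: Disk Twist intro!: sum_mono)
      then show ?thesis using IH[of ds] Cons.prems by (simp add: Disk Twist)
    qed
  qed
qed simp

text \<open>Right colours are traded for differences. At a maximum the right colour \<open>d\<close>
  becomes \<open>c - d\<close>, and at the \<open>Infinity\<close> disk the common colour of the new
  pair becomes its jump from the old left colour; both changes permute the residues.\<close>

lemma colourings_symmetric_union_le_lifts:
  assumes "q > 0" "length rs = length ls" "well_formed (length ls) E"
  shows "colourings q (ls @ rev rs) (symmetric_union (length ls) E) \<le>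
    (\<Sum>es\<in>vectors q (choices E). lifts q ls (diff_lists ls rs) es E)"
  using assms(2,3)
proof (induction E arbitrary: ls rs)
  case (Cons i E)
  show ?case
  proof (cases i)
    case (Half x)
    obtain a g b where x: "x = Slice a g b" by (cases x)
    with Cons.prems Half have l: "length ls = a + upper_ends g + b" "length rs = a + upper_ends g + b"
      and wf: "well_formed (a + lower_ends g + b) E" by auto
    from l(1) obtain xs us ys where ls: "ls = xs @ us @ ys" "length xs = a" "length us = upper_ends g"
      "length ys = b" by (rule list_split3)
    from l(2) obtain xs' us' ys' where rs: "rs = xs' @ us' @ ys'" "length xs' = a" "length us' = upper_ends g"
      "length ys' = b" by (rule list_split3)
    define G where "G vs ws = (\<Sum>es\<in>vectors q (choices E). lifts q (xs @ vs @ ys)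
       (diff_lists xs xs' @ ws @ diff_lists ys ys') es E)" for vs ws
    have IH: "colourings q ((xs @ vs @ ys) @ rev (xs' @ vs' @ ys')) (symmetric_union (a + lower_ends g + b) E)
      \<le> G vs (diff_lists vs vs')" if "length vs = lower_ends g" "length vs' = lower_ends g" for vs vs'
      using Cons.IH[of "xs' @ vs' @ ys'" "xs @ vs @ ys"] ls rs that wf by (simp add: G_def add.assoc)
    have ds: "diff_lists ls rs = diff_lists xs xs' @ diff_lists us us' @ diff_lists ys ys'"
      using ls rs by simp
    have len: "length (diff_lists xs xs') = a" "length (diff_lists us us') = upper_ends g"
      using ls rs by simp_all
    have start: "colourings q (ls @ rev rs) (symmetric_union (length ls) (i # E)) =
      spread q g us (\<lambda>vs. spread q g us' (\<lambda>vs'.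
        colourings q ((xs @ vs @ ys) @ rev (xs' @ vs' @ ys')) (symmetric_union (a + lower_ends g + b) E)))"
      unfolding Half x ls(1) rs(1) by (rule colourings_symmetric_slice) (use ls rs in auto)
    show ?thesis
    proof (cases g)
      case Cap
      then have us: "us = []" "us' = []" using ls rs by simp_all
      have "colourings q (ls @ rev rs) (symmetric_union (length ls) (i # E)) \<le>
        (\<Sum>c\<in>{0..<q}. \<Sum>d\<in>{0..<q}. G [c, c] [c - d, c - d])"
        unfolding start using IH[of "[c, c]" "[d, d]" for c d] Cap by (simp add: sum_mono)
      also have "\<dots> = (\<Sum>c\<in>{0..<q}. \<Sum>d\<in>{0..<q}. G [c, c] [d, d])"
      proof (rule sum.cong[OF refl], rule sum_congruent_reflect[OF \<open>q > 0\<close>])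
        fix c d d' assume "q dvd d - d'"
        then show "G [c, c] [d, d] = G [c, c] [d', d']" unfolding G_def
          by (intro sum.cong[OF refl] lifts_congruent list_all2_appendI)
            (use ls rs wf Cap in auto)
      qed
      also have "\<dots> = (\<Sum>d\<in>{0..<q}. \<Sum>c\<in>{0..<q}. G [c, c] [d, d])" by (rule sum.swap)
      also have "\<dots> = (\<Sum>es\<in>vectors q (choices (i # E)). lifts q ls (diff_lists ls rs) es (i # E))"
      proof -
        have "replace_strands a 0 vs ls = xs @ vs @ ys" "replace_strands a 0 vs (diff_lists ls rs) = diff_lists xs xs' @ vs @ diff_lists ys ys'"
          for vs using ls rs us by (simp_all add: replace_strands_def)
        then show ?thesis
          by (simp add: Half x Cap sum_vectors_Suc G_def) (intro sum.cong[OF refl] sum.swap)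
      qed
      finally show ?thesis .
    next
      case Cup
      then obtain u v u' v' where us: "us = [u, v]" "us' = [u', v']" using ls rs by (auto simp: length_2_conv)
      show ?thesis
      proof (cases "q dvd u - v \<and> q dvd u' - v'")
        case True
        then have "q dvd (u - u') - (v - v')" using dvd_diff[of q "u - v" "u' - v'"] by (simp add: algebra_simps)
        have eq: "ls ! a = u" "ls ! Suc a = v" "diff_lists ls rs ! a = u - u'" "diff_lists ls rs ! Suc a = v - v'"
          "replace_strands a 2 [] ls = xs @ ys" "replace_strands a 2 [] (diff_lists ls rs) = diff_lists xs xs' @ diff_lists ys ys'"
          using ls len us unfolding ds by (auto simp: nth_append replace_strands_def)
        show ?thesis unfolding start
          using IH[of "[]" "[]"] Cup us True \<open>q dvd (u - u') - (v - v')\<close> by (simp add: Half x eq G_def)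
      next
        case False
        then have "colourings q (ls @ rev rs) (symmetric_union (length ls) (i # E)) = 0"
          unfolding start using us Cup by auto
        then show ?thesis by simp
      qed
    next
      case (Cross s)
      then obtain u v u' v' where us: "us = [u, v]" "us' = [u', v']" using ls rs by (auto simp: length_2_conv)
      have eq: "ls ! a = u" "ls ! Suc a = v" "diff_lists ls rs ! a = u - u'" "diff_lists ls rs ! Suc a = v - v'"
        "replace_strands a 2 vs ls = xs @ vs @ ys" "replace_strands a 2 vs (diff_lists ls rs) = diff_lists xs xs' @ vs @ diff_lists ys ys'" for vs
        using ls len us unfolding ds by (auto simp: nth_append replace_strands_def)
      have "colourings q (ls @ rev rs) (symmetric_union (length ls) (i # E)) \<le> G (crossed s u v) (crossed s (u - u') (v - v'))"
        unfolding start using IH[of "crossed s u v" "crossed s u' v'", unfolded crossed_diff] Cross us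
        by (cases s) simp_all
      also have "\<dots> = (\<Sum>es\<in>vectors q (choices (i # E)). lifts q ls (diff_lists ls rs) es (i # E))"
        unfolding G_def Half x Cross choices.simps lifts.simps eq ..
      finally show ?thesis .
    qed
  next
    case (Disk t)
    with Cons.prems have "ls \<noteq> []" "rs \<noteq> []" and wf: "well_formed (length ls) E" by auto
    then obtain xs x xs' x' where ls: "ls = xs @ [x]" and rs: "rs = xs' @ [x']" by (metis rev_exhaust)
    have len: "length xs' = length xs" using Cons.prems ls rs by simp
    have ds: "diff_lists ls rs = diff_lists xs xs' @ [x - x']" using ls rs len by simp
    have start: "colourings q (ls @ rev rs) (symmetric_union (length ls) (i # E)) =
      colourings q (xs @ x # x' # rev xs') (axis_slices (length xs) t @ symmetric_union (length ls) E)"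
      using ls rs by (simp add: Disk)
    have IH: "colourings q (xs @ y # y' # rev xs') (symmetric_union (length ls) E) \<le>
       (\<Sum>es\<in>vectors q (choices E). lifts q (xs @ [y]) (diff_lists xs xs' @ [y - y']) es E)" for y y'
      using Cons.IH[of "xs' @ [y']" "xs @ [y]"] ls len wf by simp
    show ?thesis
    proof (cases t)
      case Infinity
      show ?thesis
      proof (cases "q dvd x - x'")
        case True
        define F where "F c = (\<Sum>es\<in>vectors q (choices E). lifts q (xs @ [c]) (diff_lists xs xs' @ [x - x']) es E)" for c
        have F: "F c = F c'" if "q dvd c - c'" for c c' unfolding F_def
          by (intro sum.cong[OF refl] lifts_congruent list_all2_appendI) (use that ls len wf in auto)
        \<comment> \<open>Below the disk the true difference at the axis is 0, while
          \<open>lifts\<close> keeps the old one; they agree modulo \<open>q\<close> by the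
          condition at the disk.\<close>
        have "(\<Sum>es\<in>vectors q (choices E). lifts q (xs @ [c]) (diff_lists xs xs' @ [c - c]) es E) = F c" for c
          unfolding F_def
          by (intro sum.cong[OF refl] lifts_congruent list_all2_appendI)
            (use True ls len wf in \<open>auto simp: dvd_diff_commute\<close>)
        then have "colourings q (ls @ rev rs) (symmetric_union (length ls) (i # E)) \<le> (\<Sum>c\<in>{0..<q}. F c)"
          unfolding start Infinity colourings_axis_infinity using IH[of c c for c] True by (simp add: sum_mono)
        also have "\<dots> = (\<Sum>c\<in>{0..<q}. F (c - - x))"
          by (rule sum_congruent_shift[OF \<open>q > 0\<close> F, symmetric])
        also have "\<dots> = (\<Sum>es\<in>vectors q (choices (i # E)). lifts q ls (diff_lists ls rs) es (i # E))"
          using True unfolding ds by (simp add: Disk Infinity sum_vectors_Suc F_def ls add.commute)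
        finally show ?thesis .
      next
        case False
        then show ?thesis unfolding start Infinity colourings_axis_infinity by simp
      qed
    next
      case (Twist k)
      have "colourings q (ls @ rev rs) (symmetric_union (length ls) (i # E)) \<le>
         (\<Sum>es\<in>vectors q (choices E). lifts q (xs @ [x + k * (x - x')]) (diff_lists xs xs' @ [x - x']) es E)"
        unfolding start Twist colourings_axis_twist
        using IH[of "x + k * (x - x')" "x' + k * (x - x')"] by simp
      then show ?thesis unfolding ds by (simp add: Disk Twist ls)
    qed
  qed
qed simp

text \<open>Sorted by \<open>es\<close>, the colourings of the union fall into at most
  \<open>q * ?N\<close> non-empty classes, the \<open>q\<close> coming from the single
  \<open>Infinity\<close> disk, and each class has at most \<open>?N\<close> elements.\<close>

lemma colourings_symmetric_union_le:
  assumes "q > 0" "symmetric_union_presentation E"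
  shows "colourings q [] (symmetric_union 0 E) \<le> nat q * (colourings q [] (partial_diagram E))\<^sup>2"
proof -
  have wf: "well_formed 0 E" and inf: "length (filter (\<lambda>x. x = Disk Infinity) E) = 1"
    using assms(2) by (auto simp: symmetric_union_presentation_def knot_diagram_def link_diagram_def)
  let ?N = "colourings q [] (partial_diagram E)"
  have "colourings q [] (symmetric_union 0 E) \<le> (\<Sum>es\<in>vectors q (choices E). lifts q [] [] es E)"
    using colourings_symmetric_union_le_lifts[of q "[]" "[]" E] assms wf by simp
  also have "\<dots> \<le> (\<Sum>es\<in>vectors q (choices E). (if \<exists>ls. lifts q ls [] es E > 0 then 1 else 0) * ?N)"
    using lifts_le_colourings[OF assms(1) wf] by (intro sum_mono) (auto simp: vectors_def)
  also have "\<dots> \<le> (nat q * ?N) * ?N"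
    unfolding sum_distrib_right[symmetric]
    using sum_liftable_le[of q "[]" E 0] assms wf inf by (intro mult_right_mono) auto
  finally show ?thesis by (simp add: power2_eq_square mult.assoc)
qed

section \<open>The family\<close>

definition isotopy_class :: "slice list \<Rightarrow> knot" where
  "isotopy_class w = {w'. knot_diagram w' \<and> isotopic w w'}"

lemma isotopic_refl: "isotopic w w"
  by (simp add: isotopic_def)

lemma isotopy_class_in_knots: "knot_diagram w \<Longrightarrow> isotopy_class w \<in> knots"
  by (auto simp: knots_def quotient_def isotopy_class_def intro!: exI[of _ w])

lemma knot_cases:
  assumes "K \<in> knots"
  obtains w where "knot_diagram w" "K = isotopy_class w"
  using assms unfolding knots_def isotopy_class_def by (auto elim!: quotientE)

lemma colourings_knot:
  assumes "K \<in> knots" "w \<in> K" "w' \<in> K" "q > 0"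
  shows "colourings q [] w = colourings q [] w'"
  using assms by (elim knot_cases) (auto simp: isotopy_class_def dest!: colourings_isotopic)

lemma colourings_presents:
  assumes "presents_with_partial K J" "K \<in> knots" "J \<in> knots" "u \<in> K" "w \<in> J" "q > 0"
  shows "colourings q [] w \<le> colourings q [] u" "colourings q [] u \<le> nat q * (colourings q [] w)\<^sup>2"
proof -
  from assms(1) obtain E where E: "symmetric_union_presentation E" "symmetric_union 0 E \<in> K"
    "partial_diagram E \<in> J" by (auto simp: presents_with_partial_def)
  have "colourings q [] u = colourings q [] (symmetric_union 0 E)"
    "colourings q [] w = colourings q [] (partial_diagram E)"
    using colourings_knot assms E by blast+
  moreover have "well_formed 0 E"
    using E(1) by (auto simp: symmetric_union_presentation_def knot_diagram_def link_diagram_def)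
  ultimately show "colourings q [] w \<le> colourings q [] u" "colourings q [] u \<le> nat q * (colourings q [] w)\<^sup>2"
    using colourings_le_symmetric_union[of q "[]" E 0] colourings_symmetric_union_le[OF \<open>q > 0\<close> E(1)] \<open>q > 0\<close>
    by simp_all
qed

lemma colourings_symmetrically_related:
  assumes "symmetrically_related J J'" "J \<in> knots" "J' \<in> knots" "w \<in> J" "w' \<in> J'" "q > 0"
  shows "colourings q [] w \<le> nat q * (colourings q [] w')\<^sup>2"
proof -
  from assms(1) obtain K where K: "K \<in> knots" "presents_with_partial K J" "presents_with_partial K J'"
    by (auto simp: symmetrically_related_def)
  from K(2) obtain u where "u \<in> K" by (auto simp: presents_with_partial_def)
  then show ?thesis using colourings_presents K assms by (meson order_trans)
qed

lemma symmetrically_related_commute: "symmetrically_related J J' \<Longrightarrow> symmetrically_related J' J"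
  by (auto simp: symmetrically_related_def)

text \<open>These are the orders of the cyclic summands in the first homology of the double branched
  cover. For \<open>1 \<le> r \<le> N\<close> their product is \<open>3 ^ N\<close> whatever
  \<open>r\<close> is, while the 3-rank is \<open>r\<close>.\<close>

definition summand_orders :: "nat \<Rightarrow> nat \<Rightarrow> nat list" where
  "summand_orders N r = replicate (r - 1) 3 @ [3 ^ (N - r + 1)]"

lemma summand_orders_power3: "a \<in> set (summand_orders N r) \<Longrightarrow> \<exists>k. a = 3 ^ Suc k"
  unfolding summand_orders_def by (auto intro: exI[of _ 0] split: if_splits)

lemma prod_summand_orders:
  assumes "1 \<le> r" "r \<le> N"
  shows "prod_list (summand_orders N r) = 3 ^ N"
proof -
  have "r - 1 + (N - r + 1) = N" using assms by simp
  then have "(3::nat) ^ N = 3 ^ (r - 1) * 3 ^ (N - r + 1)" by (metis power_add)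
  then show ?thesis by (simp add: summand_orders_def)
qed

lemma colourings_summand_orders_3:
  assumes "1 \<le> r"
  shows "colourings 3 [] (torus_sum (summand_orders N r)) = 3 ^ (r + 1)"
proof -
  have "nat (gcd (int a) 3) = 3" if "a \<in> set (summand_orders N r)" for a
    using summand_orders_power3[OF that] by auto
  then have "map (\<lambda>a. nat (gcd (int a) 3)) (summand_orders N r) = map (\<lambda>_. 3) (summand_orders N r)"
    by (intro map_cong) auto
  moreover have "length (summand_orders N r) = r" using assms by (simp add: summand_orders_def)
  ultimately show ?thesis by (simp add: colourings_torus_sum map_replicate_const)
qed

lemma colourings_summand_orders_multiple:
  assumes "1 \<le> r" "r \<le> N" "q > 0" "3 ^ N dvd q"
  shows "colourings q [] (torus_sum (summand_orders N r)) = nat (q * 3 ^ N)"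
proof -
  have "nat (gcd (int a) q) = a" if "a \<in> set (summand_orders N r)" for a
  proof -
    have "a = 3 ^ 1 \<or> a = 3 ^ (N - r + 1)" using that by (auto simp: summand_orders_def)
    then have "a dvd 3 ^ N" using assms(1,2) le_imp_power_dvd[of 1 N "3::nat"]
        le_imp_power_dvd[of "N - r + 1" N "3::nat"] by auto
    then have "int a dvd q" using assms(4) by (metis dvd_trans of_nat_dvd_iff of_nat_numeral of_nat_power)
    then show ?thesis by (simp add: gcd_proj1_if_dvd)
  qed
  then have "map (\<lambda>a. nat (gcd (int a) q)) (summand_orders N r) = summand_orders N r"
    by (intro map_idI) auto
  then show ?thesis using assms prod_summand_orders
    by (simp add: colourings_torus_sum nat_mult_distrib nat_power_eq)
qed

lemma colourings_summand_orders_2: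
  "colourings (2 ^ k) [] (torus_sum (summand_orders N r)) = 2 ^ k"
proof -
  have "nat (gcd (int a) (2 ^ k)) = 1" if "a \<in> set (summand_orders N r)" for a
  proof -
    have "coprime (int a) (2 ^ k)" using summand_orders_power3[OF that] by auto
    then show ?thesis by (simp add: coprime_iff_gcd_eq_1)
  qed
  then have "map (\<lambda>a. nat (gcd (int a) (2 ^ k))) (summand_orders N r) = map (\<lambda>_. 1) (summand_orders N r)"
    by (intro map_cong) auto
  then show ?thesis by (simp add: colourings_torus_sum map_replicate_const nat_power_eq)
qed

lemma knot_diagram_summand_orders: "knot_diagram (torus_sum (summand_orders N r))"
  by (rule knot_diagram_torus_sum) (auto dest: summand_orders_power3)

text \<open>\<open>knot_determinant\<close> evaluates an unspecified diagram of the class. That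
  diagram shares all colouring numbers with the explicit torus sum, and these fix its
  determinant.\<close>

lemma determinant_summand_orders:
  assumes "1 \<le> r" "r \<le> N"
  shows "knot_determinant (isotopy_class (torus_sum (summand_orders N r))) = 3 ^ N"
proof -
  define u where "u = torus_sum (summand_orders N r)"
  define w where "w = (SOME w. w \<in> isotopy_class u)"
  have "u \<in> isotopy_class u"
    using knot_diagram_summand_orders by (simp add: isotopy_class_def isotopic_refl u_def)
  then have w: "w \<in> isotopy_class u" unfolding w_def by (rule someI)
  then have "link_diagram w" "w \<noteq> []" by (auto simp: isotopy_class_def knot_diagram_def)
  moreover have "colourings q [] w = colourings q [] u" if "q > 0" for q
    using w colourings_isotopic[OF _ that, of u w] by (simp add: isotopy_class_def)
  ultimately have "diagram_determinant w = 3 ^ N"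
    using colourings_summand_orders_multiple[OF assms] colourings_summand_orders_2
    by (intro diagram_determinant_from_colourings) (simp_all add: u_def)
  then show ?thesis by (simp add: knot_determinant_def w_def u_def)
qed

theorem corollary1p4:
  fixes m :: nat
  shows "\<exists>\<K>. \<K> \<subseteq> knots \<and> card \<K> = 2 ^ m \<and>
    (\<forall>K \<in> \<K>. \<forall>K' \<in> \<K>. knot_determinant K = knot_determinant K') \<and>
    (\<forall>K \<in> \<K>. \<forall>K' \<in> \<K>. K \<noteq> K' \<longrightarrow> \<not> symmetrically_related K K')"
proof -
  \<comment> \<open>An upper bound for the ranks \<open>5 ^ i\<close> with
    \<open>i < 2 ^ m\<close>.\<close>
  define N :: nat where "N = 5 ^ 2 ^ m"
  define w where "w i = torus_sum (summand_orders N (5 ^ i))" for i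
  define K where "K i = isotopy_class (w i)" for i
  have knot: "K i \<in> knots" for i
    unfolding K_def w_def by (rule isotopy_class_in_knots, rule knot_diagram_summand_orders)
  have mem: "w i \<in> K i" for i
    by (simp add: K_def w_def isotopy_class_def isotopic_refl knot_diagram_summand_orders)
  have col: "colourings 3 [] (w i) = 3 ^ (5 ^ i + 1)" for i
    unfolding w_def by (rule colourings_summand_orders_3) simp
  have "inj K"
  proof (rule injI)
    fix i j assume "K i = K j"
    then have "colourings 3 [] (w i) = colourings 3 [] (w j)"
      using colourings_knot[OF knot mem, of "w j" i 3] mem[of j] by simp
    then show "i = j" by (simp add: col)
  qed
  have unrelated: "\<not> symmetrically_related (K i) (K j)" if "j < i" for i j
  proof
    assume "symmetrically_related (K i) (K j)"
    then have "colourings 3 [] (w i) \<le> 3 * (colourings 3 [] (w j))\<^sup>2"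
      using colourings_symmetrically_related[OF _ knot knot mem mem, of i j 3] by simp
    \<comment> \<open>The exponent on the right is \<open>1 + 2 * (5 ^ j + 1)\<close>. The resulting
      inequality of ranks contradicts
      \<open>5 ^ i \<ge> 5 * 5 ^ j \<ge> 2 * 5 ^ j + 3\<close>.\<close>
    then have "(3::nat) ^ (5 ^ i + 1) \<le> 3 ^ (2 * 5 ^ j + 3)"
      by (simp add: col power_mult_distrib flip: power_mult) (simp add: power_add mult.commute)
    then have "5 ^ i + 1 \<le> 2 * 5 ^ j + (3::nat)"
      by (rule power_le_imp_le_exp[rotated]) simp
    moreover have "5 * 5 ^ j \<le> (5::nat) ^ i"
      using power_increasing[of "Suc j" i "5::nat"] that by simp
    moreover have "(5::nat) ^ j \<ge> 1" by simp
    ultimately show False by linarith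
  qed
  have "K i \<noteq> K j \<Longrightarrow> \<not> symmetrically_related (K i) (K j)" for i j
    using unrelated symmetrically_related_commute by (metis linorder_neqE_nat)
  moreover have "knot_determinant (K i) = 3 ^ N" if "i < 2 ^ m" for i
    unfolding K_def w_def using that
    by (intro determinant_summand_orders) (auto simp: N_def intro!: power_increasing)
  moreover have "card (K ` {..<2 ^ m}) = 2 ^ m"
    using \<open>inj K\<close> by (simp add: card_image inj_on_subset)
  ultimately show ?thesis using knot by (intro exI[of _ "K ` {..<2 ^ m}"]) auto
qed

end
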